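(* Let $\zeta\colon\mathbb Z_2\times\mathbb Z_2\to\mathbb C(q)^\times$ be the normalized 2-cocycle given by $\zeta(\bar{\mathbf i},\bar{\mathbf j})=(-1)^{\bar{\mathbf i}\,\bar{\mathbf j}}$. Then the assignment $l^\pm_{ij}\mapsto l^\pm_{ij}$ (on all generators) gives rise to a superalgebra isomorphism $\widetilde U(R)\to U(R)^\zeta$, where $U(R)$ is the extended orthosymplectic RLL superalgebra, $U(R)^\zeta$ its twist by $\zeta$, and $\widetilde U(R)$ the twisted RLL superalgebra.
   Context: Data: $V$ is a complex superspace of dimension $(m,n)$ with $n$ even, $N=m+n$, $s=\lfloor N/2\rfloor$, ordered homogeneous basis $v_1,\dots,v_N$, $\bar i:=|v_i|$, $i':=N+1-i$, with $\bar i=\overline{i'}$ for all $i$ (so $v_{s+1}$ is even if $N$ is odd). Signs $\vartheta_i\in\{\pm1\}$ are chosen with $\vartheta_i=1$ if $\bar i=\bar0$ and $\vartheta_i=-\vartheta_{i'}$ if $\bar i=\bar1$. Let $\varepsilon_1,\dots,\varepsilon_s$ be linearly independent with $(\varepsilon_i,\varepsilon_j)=\delta_{ij}(-1)^{\bar i}$; put $\varepsilon_{i'}=-\varepsilon_i$, and $\varepsilon_{s+1}=0$ if $N$ is odd. $\Phi^+=\{\varepsilon_a-\varepsilon_b\mid a<b<a'\}\cup\{2\varepsilon_a\mid\bar a=\bar1,\ a\le s\}$, where $\varepsilon_a-\varepsilon_b$ has parity $\bar a+\bar b$ and $2\varepsilon_a$ is even; $\rho$ is half the sum of the even elements of $\Phi^+$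 minus half the sum of the odd elements. $V_q=\mathbb C(q)\otimes V$, matrix units $E_{ij}$ of parity $\bar i+\bar j$; $$R=q^{-1}\sum_{i,j}q^{-(\varepsilon_i,\varepsilon_j)}E_{ii}\otimes E_{jj}-(q-q^{-1})q^{-1}\sum_{i<j}(-1)^{\bar j}E_{ij}\otimes\Bigl(E_{ji}-(-1)^{\bar j(\bar i+\bar j)}\vartheta_i\vartheta_j\,q^{(\rho,\varepsilon_i-\varepsilon_j)-\frac12(\varepsilon_i,\varepsilon_i)+\frac12(\varepsilon_j,\varepsilon_j)}E_{i'j'}\Bigr).$$ Let $\mathcal T$ be the free $\mathbb C(q)$-superalgebra on $l^+_{ij},l^-_{ji}$ ($1\le i\le j\le N$), $|l^\pm_{ij}|=\bar i+\bar j$; put $l^+_{ij}=0=l^-_{ji}$ for $i>j$, $L^\pm_1=\sum l^\pm_{ij}\otimes E_{ij}\otimes\mathrm I$, $L^\pm_2=\sum l^\pm_{ij}\otimes\mathrm I\otimes E_{ij}$, $R_{12}=1\otimes R$. Regard $\mathcal T$ and $\mathrm{End}(V_q)$ as graded by $G=\mathbb Z_2\times\mathbb Z_2$, with elements of $\mathcal T$ of degree $(|x|,0)$ and elements of $\mathrm{End}(V_q)$ of degree $(0,|X|)$. For a bicharacter $\beta\colon G\times G\to\{\pm1\}$, $A\otimes^\beta B$ denotes $A\otimes B$ with product $(a\otimes b)(a'\otimes b')=\beta(|b|_G,|a'|_G)\,aa'\otimes bb'$ (iterated for several factors). Let $\beta(g,h)=(-1)^{(g_1+g_2)(h_1+h_2)}$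 and $\beta'(g,h)=(-1)^{g_1h_1+g_2h_2}$. (Thus $\otimes^\beta$ is the usual tensor product of superalgebras, while with $\beta'$ no sign appears when interchanging an element of $\mathcal T$ with an element of $\mathrm{End}(V_q)$, but the usual sign appears between the two factors $\mathrm{End}(V_q)$.) $U(R)$ is the quotient of $\mathcal T$ by $l^\pm_{ii}l^\mp_{ii}=1$ and all coefficients of $R_{12}L^\pm_1L^\pm_2=L^\pm_2L^\pm_1R_{12}$ and $R_{12}L^+_1L^-_2=L^-_2L^+_1R_{12}$ computed in $\mathcal T\otimes^\beta\mathrm{End}(V_q)^{\otimes2}$. $\widetilde U(R)$ is defined identically (same generators, same diagonal relations, same matrix relations), but with the matrix equations computed in $\mathcal T\otimes^{\beta'}\mathrm{End}(V_q)^{\otimes2}$. For a superalgebra $A$ and a normalized 2-cocycle $\zeta$ on $\mathbb Z_2$, $A^\zeta$ is the superspace $A$ with product $a\cdot_\zeta a'=\zeta(|a|,|a'|)\,aa'$ on homogeneous elements. *)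

theory Defs
  imports
    "HOL-Computational_Algebra.Fraction_Field"
    "HOL-Computational_Algebra.Polynomial"
    "HOL-Library.Poly_Mapping"
    "HOL-Library.Product_Plus"
    "HOL-Library.Z2"
    "HOL-Algebra.Module"
    "HOL-Algebra.QuotRing"
    "HOL-Algebra.Algebraic_Closure_Type"
begin

hide_const (open) Poly_Mapping.degree Polynomial.degree Polynomial.smult

section \<open>The ground field and signs\<close>

type_synonym ratfun = "complex poly fract"

definition qvar :: ratfun where
  "qvar = Fract [:0, 1:] 1"

definition parity_sign :: "bit \<Rightarrow> 'a::ring_1" where
  "parity_sign x = (if x = 0 then 1 else - 1)"


section \<open>Superalgebras over a field\<close>

record ('k, 'a) superalgebra = "('k, 'a) module" +
  homog :: "bit \<Rightarrow> 'a set"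

locale superalgebra = ring A for A :: "('k::field, 'a, 'm) superalgebra_scheme" (structure) +
  assumes module: "module (ring_of_type_algebra :: 'k ring) A"
    and smult_mult_left: "\<lbrakk>x \<in> carrier A; y \<in> carrier A\<rbrakk> \<Longrightarrow> (c \<odot> x) \<otimes> y = c \<odot> (x \<otimes> y)"
    and smult_mult_right: "\<lbrakk>x \<in> carrier A; y \<in> carrier A\<rbrakk> \<Longrightarrow> x \<otimes> (c \<odot> y) = c \<odot> (x \<otimes> y)"
    and homog_submodule: "submodule (homog A d) (ring_of_type_algebra :: 'k ring) A"
    and homog_decomposition:
      "x \<in> carrier A \<Longrightarrow> \<exists>!(y, z). y \<in> homog A 0 \<and> z \<in> homog A 1 \<and> x = y \<oplus> z"
    and homog_one: "\<one> \<in> homog A 0"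
    and homog_mult: "\<lbrakk>x \<in> homog A d; y \<in> homog A e\<rbrakk> \<Longrightarrow> x \<otimes> y \<in> homog A (d + e)"

definition superalgebra_iso ::
  "('k::field, 'a, 'm) superalgebra_scheme \<Rightarrow> ('k, 'b, 'n) superalgebra_scheme \<Rightarrow> ('a \<Rightarrow> 'b) \<Rightarrow> bool"
  where
  "superalgebra_iso A B f \<longleftrightarrow>
     superalgebra A \<and> superalgebra B \<and> f \<in> ring_iso A B \<and>
     (\<forall>c. \<forall>x\<in>carrier A. f (c \<odot>\<^bsub>A\<^esub> x) = c \<odot>\<^bsub>B\<^esub> f x) \<and>
     (\<forall>d. f ` homog A d \<subseteq> homog B d)"

text \<open>The quotient by a two-sided ideal; it is a superalgebra when the ideal is generated by
  homogeneous elements.\<close>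

definition quotient_superalgebra ::
  "('k, 'a, 'm) superalgebra_scheme \<Rightarrow> 'a set \<Rightarrow> ('k, 'a set) superalgebra" where
  "quotient_superalgebra A I =
     \<lparr>carrier = carrier (A Quot I), monoid.mult = monoid.mult (A Quot I),
      one = one (A Quot I), zero = zero (A Quot I), add = add (A Quot I),
      smult = (\<lambda>c C. (\<Union>x\<in>C. I +>\<^bsub>A\<^esub> (c \<odot>\<^bsub>A\<^esub> x))),
      homog = (\<lambda>d. (\<lambda>x. I +>\<^bsub>A\<^esub> x) ` homog A d)\<rparr>"


section \<open>Cocycle twists\<close>

definition normalized_2cocycle :: "(bit \<Rightarrow> bit \<Rightarrow> 'k::field) \<Rightarrow> bool" where
  "normalized_2cocycle \<zeta> \<longleftrightarrow>
     (\<forall>a b. \<zeta> a b \<noteq> 0) \<and> (\<forall>a b c. \<zeta> a b * \<zeta> (a + b) c = \<zeta> b c * \<zeta> a (b + c)) \<and>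
     (\<forall>a. \<zeta> a 0 = 1 \<and> \<zeta> 0 a = 1)"

text \<open>The twisted product is \<open>\<zeta> d e \<odot> (x \<otimes> y)\<close> for \<open>x\<close>, \<open>y\<close> homogeneous of parities \<open>d\<close>, \<open>e\<close>,
  extended bilinearly along the decomposition into homogeneous parts.\<close>

definition homog_part :: "('k, 'a, 'm) superalgebra_scheme \<Rightarrow> bit \<Rightarrow> 'a \<Rightarrow> 'a" where
  "homog_part A d x =
     (THE y. y \<in> homog A d \<and> (\<exists>z\<in>homog A (d + 1). x = y \<oplus>\<^bsub>A\<^esub> z))"

definition twist ::
  "(bit \<Rightarrow> bit \<Rightarrow> 'k) \<Rightarrow> ('k, 'a, 'm) superalgebra_scheme \<Rightarrow> ('k, 'a, 'm) superalgebra_scheme"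
  where
  "twist \<zeta> A = A\<lparr>monoid.mult := \<lambda>x y.
     finsum A (\<lambda>(d, e). \<zeta> d e \<odot>\<^bsub>A\<^esub> (homog_part A d x \<otimes>\<^bsub>A\<^esub> homog_part A e y))
       ({0, 1} \<times> {0, 1})\<rparr>"

definition zeta :: "bit \<Rightarrow> bit \<Rightarrow> ratfun" where
  "zeta a b = parity_sign (a * b)"

lemma normalized_2cocycle_zeta: "normalized_2cocycle zeta"
  unfolding normalized_2cocycle_def
proof (intro conjI allI)
  fix a b c :: bit
  show "zeta a b * zeta (a + b) c = zeta b c * zeta a (b + c)"
    by (cases a; cases b; cases c) (simp_all add: zeta_def parity_sign_def)
qed (simp_all add: zeta_def parity_sign_def)


section \<open>Graded algebras with a homogeneous basis\<close>

text \<open>An algebra over the field of rational functions is described by a basis whose elements are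
  homogeneous with respect to a grading group, by the products of basis elements and by the unit.
  Its elements are the finitely supported families of coefficients on the basis.\<close>

record ('g, 'b) based_algebra =
  basis :: "'b set"
  bdeg :: "'b \<Rightarrow> 'g"
  bprod :: "'b \<Rightarrow> 'b \<Rightarrow> ('b \<Rightarrow>\<^sub>0 ratfun)"
  bunit :: "'b \<Rightarrow>\<^sub>0 ratfun"

definition scale :: "ratfun \<Rightarrow> ('b \<Rightarrow>\<^sub>0 ratfun) \<Rightarrow> ('b \<Rightarrow>\<^sub>0 ratfun)" where
  "scale c = Poly_Mapping.map ((*) c)"

definition alg_mult ::
  "('g, 'b) based_algebra \<Rightarrow> ('b \<Rightarrow>\<^sub>0 ratfun) \<Rightarrow> ('b \<Rightarrow>\<^sub>0 ratfun) \<Rightarrow> ('b \<Rightarrow>\<^sub>0 ratfun)" where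
  "alg_mult A x y =
     (\<Sum>a\<in>Poly_Mapping.keys x. \<Sum>b\<in>Poly_Mapping.keys y.
        scale (Poly_Mapping.lookup x a * Poly_Mapping.lookup y b) (bprod A a b))"

definition pure_tensor ::
  "('a \<Rightarrow>\<^sub>0 ratfun) \<Rightarrow> ('b \<Rightarrow>\<^sub>0 ratfun) \<Rightarrow> ('a \<times> 'b \<Rightarrow>\<^sub>0 ratfun)" (infixr "\<otimes>\<^sub>p" 72) where
  "x \<otimes>\<^sub>p y =
     (\<Sum>a\<in>Poly_Mapping.keys x. \<Sum>b\<in>Poly_Mapping.keys y.
        Poly_Mapping.single (a, b) (Poly_Mapping.lookup x a * Poly_Mapping.lookup y b))"

text \<open>The product \<open>(a \<otimes> b)(a' \<otimes> b') = \<beta>(|b|, |a'|) aa' \<otimes> bb'\<close> on basis elements.\<close>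

definition tensor_algebra ::
  "('g::plus \<Rightarrow> 'g \<Rightarrow> ratfun) \<Rightarrow> ('g, 'a) based_algebra \<Rightarrow> ('g, 'b) based_algebra
     \<Rightarrow> ('g, 'a \<times> 'b) based_algebra" where
  "tensor_algebra \<beta> A B =
     \<lparr>basis = basis A \<times> basis B,
      bdeg = (\<lambda>(a, b). bdeg A a + bdeg B b),
      bprod = (\<lambda>(a, b) (a', b').
        scale (\<beta> (bdeg B b) (bdeg A a')) (bprod A a a' \<otimes>\<^sub>p bprod B b b')),
      bunit = bunit A \<otimes>\<^sub>p bunit B\<rparr>"

definition regrade :: "('g \<Rightarrow> 'h) \<Rightarrow> ('g, 'b) based_algebra \<Rightarrow> ('h, 'b) based_algebra" where
  "regrade f A =
     \<lparr>basis = basis A, bdeg = (\<lambda>b. f (bdeg A b)), bprod = bprod A, bunit = bunit A\<rparr>"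

text \<open>For a grading by \<open>\<int>\<^sub>2\<close>: the superalgebra spanned by the basis.\<close>

definition superalgebra_of ::
  "(bit, 'b) based_algebra \<Rightarrow> (ratfun, 'b \<Rightarrow>\<^sub>0 ratfun) superalgebra" where
  "superalgebra_of A =
     \<lparr>carrier = {x. Poly_Mapping.keys x \<subseteq> basis A}, monoid.mult = alg_mult A,
      one = bunit A, zero = 0, add = (+), smult = scale,
      homog = (\<lambda>d. {x. Poly_Mapping.keys x \<subseteq> {b \<in> basis A. bdeg A b = d}})\<rparr>"

text \<open>The two bicharacters on \<open>\<int>\<^sub>2 \<times> \<int>\<^sub>2\<close>.\<close>

definition beta_total :: "bit \<times> bit \<Rightarrow> bit \<times> bit \<Rightarrow> ratfun" where
  "beta_total g h = parity_sign ((fst g + snd g) * (fst h + snd h))"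

definition beta_split :: "bit \<times> bit \<Rightarrow> bit \<times> bit \<Rightarrow> ratfun" where
  "beta_split g h = parity_sign (fst g * fst h + snd g * snd h)"


section \<open>Orthosymplectic data\<close>

locale osp_data =
  fixes m n :: nat and par :: "nat \<Rightarrow> bit" and \<theta> :: "nat \<Rightarrow> int"
  assumes even_n: "even n"
    and card_even: "card {i \<in> {1..m + n}. par i = 0} = m"
    and card_odd: "card {i \<in> {1..m + n}. par i = 1} = n"
    and par_sym: "i \<in> {1..m + n} \<Longrightarrow> par (m + n + 1 - i) = par i"
    and theta_sign: "i \<in> {1..m + n} \<Longrightarrow> \<theta> i = 1 \<or> \<theta> i = - 1"
    and theta_even: "\<lbrakk>i \<in> {1..m + n}; par i = 0\<rbrakk> \<Longrightarrow> \<theta> i = 1"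
    and theta_odd: "\<lbrakk>i \<in> {1..m + n}; par i = 1\<rbrakk> \<Longrightarrow> \<theta> i = - \<theta> (m + n + 1 - i)"

text \<open>\<open>\<theta>\<close> is the sign function \<open>\<vartheta>\<close>, \<open>par i\<close> the parity of \<open>v\<^sub>i\<close>, and only indices in \<open>{1..m + n}\<close> matter.
  Weights are coordinate vectors with respect to \<open>\<epsilon>\<^sub>1, \<dots>, \<epsilon>\<^sub>s\<close>, where \<open>s = N div 2\<close>.\<close>

type_synonym weight = "nat \<Rightarrow> rat"

definition dual_index :: "nat \<Rightarrow> nat \<Rightarrow> nat" where
  "dual_index N i = N + 1 - i"

definition eps :: "nat \<Rightarrow> nat \<Rightarrow> weight" where
  "eps N i =
     (if i \<le> N div 2 then (\<lambda>k. if k = i then 1 else 0)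
      else if dual_index N i \<le> N div 2 then (\<lambda>k. if k = dual_index N i then - 1 else 0)
      else (\<lambda>k. 0))"

definition weight_form :: "nat \<Rightarrow> (nat \<Rightarrow> bit) \<Rightarrow> weight \<Rightarrow> weight \<Rightarrow> rat" where
  "weight_form N par x y = (\<Sum>k = 1..N div 2. parity_sign (par k) * x k * y k)"

text \<open>Positive roots, each paired with its parity.\<close>

definition pos_roots :: "nat \<Rightarrow> (nat \<Rightarrow> bit) \<Rightarrow> (weight \<times> bit) set" where
  "pos_roots N par =
     {((\<lambda>k. eps N a k - eps N b k), par a + par b) | a b. 1 \<le> a \<and> a < b \<and> b < dual_index N a} \<union>
     {((\<lambda>k. 2 * eps N a k), 0) | a. 1 \<le> a \<and> a \<le> N div 2 \<and> par a = 1}"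

definition rho :: "nat \<Rightarrow> (nat \<Rightarrow> bit) \<Rightarrow> weight" where
  "rho N par k =
     (1 / 2) * (\<Sum>(\<alpha>, p)\<in>{r \<in> pos_roots N par. snd r = 0}. \<alpha> k)
     - (1 / 2) * (\<Sum>(\<alpha>, p)\<in>{r \<in> pos_roots N par. snd r = 1}. \<alpha> k)"

definition R_exponent :: "nat \<Rightarrow> (nat \<Rightarrow> bit) \<Rightarrow> nat \<Rightarrow> nat \<Rightarrow> rat" where
  "R_exponent N par i j =
     weight_form N par (rho N par) (\<lambda>k. eps N i k - eps N j k)
     - (1 / 2) * weight_form N par (eps N i) (eps N i)
     + (1 / 2) * weight_form N par (eps N j) (eps N j)"

text \<open>The floor only serves to pass from \<open>rat\<close> to \<open>int\<close>; the exponents occurring in \<open>R\<close> are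
  integers, see \<open>weight_form_eps_Ints\<close> and \<open>R_exponent_Ints\<close> below.\<close>

definition qpow :: "rat \<Rightarrow> ratfun" where
  "qpow r = qvar powi \<lfloor>r\<rfloor>"

lemma parity_sign_Ints: "(parity_sign p :: rat) \<in> \<int>"
  by (simp add: parity_sign_def)

lemma eps_Ints: "eps N i k \<in> \<int>"
  by (simp add: eps_def)

lemma weight_form_eps_Ints: "weight_form N par (eps N i) (eps N j) \<in> \<int>"
  unfolding weight_form_def by (intro Ints_sum Ints_mult parity_sign_Ints eps_Ints)

context
begin

private lemma of_int_parity_sign: "of_int (parity_sign p) = (parity_sign p :: rat)"
  by (simp add: parity_sign_def)

private definition ev :: "rat set" where "ev = range (\<lambda>z. 2 * of_int z)"

private lemma ev_add: "x \<in> ev \<Longrightarrow> y \<in> ev \<Longrightarrow> x + y \<in> ev"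
  unfolding ev_def by (auto simp: image_iff) (metis distrib_left of_int_add)

private lemma ev_uminus: "x \<in> ev \<Longrightarrow> - x \<in> ev"
  unfolding ev_def by (auto simp: image_iff) (metis mult_minus_right of_int_minus)

private lemma ev_diff: "x \<in> ev \<Longrightarrow> y \<in> ev \<Longrightarrow> x - y \<in> ev"
  using ev_add[OF _ ev_uminus] by force

private lemma ev_sum: "(\<And>i. i \<in> I \<Longrightarrow> f i \<in> ev) \<Longrightarrow> sum f I \<in> ev"
proof (induction I rule: infinite_finite_induct)
  case (insert i I)
  then show ?case by (simp add: ev_add)
qed (auto simp: ev_def image_iff intro: exI[of _ 0])

private lemma ev_of_int: "even z \<Longrightarrow> of_int z \<in> ev"
  unfolding ev_def by (auto simp: image_iff)

private lemma eps_apply: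
  assumes "i \<in> {1..N}" "k \<in> {1..N div 2}"
  shows "eps N i k = of_bool (i = k) - of_bool (i = N + 1 - k)"
  using assms by (auto simp: eps_def dual_index_def)

private lemma eps_zero:
  assumes "i \<in> {1..N}" "k \<notin> {1..N div 2}"
  shows "eps N i k = 0"
  using assms by (auto simp: eps_def dual_index_def)

private definition pairs :: "nat \<Rightarrow> (nat \<times> nat) set" where
  "pairs N = {(a, b). 1 \<le> a \<and> a < b \<and> b < N + 1 - a}"

private lemma pairsD:
  assumes "(a, b) \<in> pairs N"
  shows "a \<in> {1..N}" "b \<in> {1..N}" "a \<in> {1..N div 2}"
    "a < b" "b < N + 1 - a"
  using assms by (auto simp: pairs_def)

private lemma finite_pairs: "finite (pairs N)"
  by (rule finite_subset[of _ "{1..N} \<times> {1..N}"]) (auto simp: pairs_def)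

private definition rt :: "nat \<Rightarrow> nat \<times> nat \<Rightarrow> weight" where
  "rt N = (\<lambda>(a, b) k. eps N a k - eps N b k)"

private lemma rt_self: "(a, b) \<in> pairs N \<Longrightarrow> rt N (a, b) a = 1"
  using pairsD[of a b N] by (simp add: rt_def eps_apply)

private lemma rt_below: "(a, b) \<in> pairs N \<Longrightarrow> c < a \<Longrightarrow> rt N (a, b) c = 0"
  using pairsD[of a b N] by (cases "c = 0") (auto simp: rt_def eps_apply eps_zero)

private lemma eps_inj:
  assumes eq: "eps N b = eps N d" and b: "b \<in> {1..N}" and d: "d \<in> {1..N}"
  shows "b = d"
proof -
  have v: "(of_bool (b = k) - of_bool (b = N + 1 - k) :: rat) = of_bool (d = k) - of_bool (d = N + 1 - k)"
    if "k \<in> {1..N div 2}" for k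
    using fun_cong[OF eq, of k] eps_apply[OF b that] eps_apply[OF d that] by simp
  have "d = b \<or> b \<notin> {1..N div 2}" "d = b \<or> N + 1 - b \<notin> {1..N div 2}"
    using v[of b] v[of "N + 1 - b"] b d by (force simp: of_bool_def split: if_splits)+
  moreover have "d = b \<or> d \<notin> {1..N div 2}" "d = b \<or> N + 1 - d \<notin> {1..N div 2}"
    using v[of d] v[of "N + 1 - d"] b d by (force simp: of_bool_def split: if_splits)+
  ultimately show ?thesis using b d by auto
qed

private lemma rt_inj: "inj_on (rt N) (pairs N)"
proof (rule inj_onI, clarify)
  fix a b c d
  assume *: "(a, b) \<in> pairs N" "(c, d) \<in> pairs N" "rt N (a, b) = rt N (c, d)"
  have "\<not> a < c" "\<not> c < a"
    using * rt_self rt_below by (metis zero_neq_one)+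
  then have ac: "a = c" by simp
  have "eps N b k = eps N d k" for k
    using fun_cong[OF *(3), of k] ac by (simp add: rt_def)
  then have "eps N b = eps N d" by (rule ext)
  then show "a = c \<and> b = d" using ac eps_inj pairsD(2) * by blast
qed

private definition longs :: "nat \<Rightarrow> (nat \<Rightarrow> bit) \<Rightarrow> nat set" where
  "longs N par = {a. 1 \<le> a \<and> a \<le> N div 2 \<and> par a = 1}"

private lemma two_rho:
  "2 * rho N par k =
     (\<Sum>(a, b)\<in>pairs N. parity_sign (par a + par b) * (eps N a k - eps N b k))
     + (\<Sum>a\<in>longs N par. 2 * eps N a k)"
proof -
  define f where "f = (\<lambda>(a, b). (rt N (a, b), par a + par b))"
  define g where "g = (\<lambda>a. ((\<lambda>k. 2 * eps N a k) :: weight, 0 :: bit))"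
  define h where "h = (\<lambda>(\<alpha> :: weight, p). parity_sign p * \<alpha> k)"
  have roots: "pos_roots N par = f ` pairs N \<union> g ` longs N par"
  proof -
    have "{((\<lambda>k. eps N a k - eps N b k), par a + par b) | a b. 1 \<le> a \<and> a < b \<and> b < dual_index N a}
        = f ` pairs N"
      unfolding f_def pairs_def rt_def dual_index_def
      by (rule Set.set_eqI, simp only: mem_Collect_eq image_iff Bex_def split_paired_Ex case_prod_conv) blast
    moreover have "{((\<lambda>k. 2 * eps N a k), 0) | a. 1 \<le> a \<and> a \<le> N div 2 \<and> par a = 1} = g ` longs N par"
      unfolding g_def longs_def by (auto simp: image_iff)
    ultimately show ?thesis unfolding pos_roots_def by simp
  qed
  have fin: "finite (pairs N)" "finite (longs N par)"
    by (auto simp: finite_pairs longs_def)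
  have inj_f: "inj_on f (pairs N)"
  proof (rule inj_onI)
    fix p r assume *: "p \<in> pairs N" "r \<in> pairs N" "f p = f r"
    then have "rt N p = rt N r" by (simp add: f_def case_prod_unfold)
    then show "p = r" using rt_inj[of N] * by (simp add: inj_on_def)
  qed
  have inj_g: "inj_on g (longs N par)"
  proof (rule inj_onI)
    fix a c assume *: "a \<in> longs N par" "c \<in> longs N par" "g a = g c"
    then have "(\<lambda>k. 2 * eps N a k) = (\<lambda>k. 2 * eps N c k)" by (simp add: g_def)
    then have "eps N a k = eps N c k" for k using fun_cong[of _ _ k] by fastforce
    then have "eps N a = eps N c" by (rule ext)
    then show "a = c" by (rule eps_inj) (use * in \<open>auto simp: longs_def\<close>)
  qed
  have disj: "f ` pairs N \<inter> g ` longs N par = {}"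
  proof -
    have False if ab: "(a, b) \<in> pairs N" and c: "c \<in> longs N par" and eq: "f (a, b) = g c" for a b c
    proof -
      have "rt N (a, b) a = 2 * eps N c a"
        using eq by (simp add: f_def g_def)
      then have "1 = 2 * eps N c a" using rt_self[OF ab] by simp
      moreover have "eps N c a = of_bool (c = a)"
        using c by (auto simp: longs_def eps_def)
      ultimately show False by (auto simp: of_bool_def split: if_splits)
    qed
    then have no: "f p \<noteq> g c" if "p \<in> pairs N" "c \<in> longs N par" for p c
      using that by (metis surj_pair)
    show ?thesis
    proof (rule Int_emptyI)
      fix x assume "x \<in> f ` pairs N" "x \<in> g ` longs N par"
      then show False using no by (elim imageE) simp
    qed
  qed
  have finr: "finite (pos_roots N par)" using roots fin by simp
  have split: "pos_roots N par
      = {r \<in> pos_roots N par. snd r = 0} \<union> {r \<in> pos_roots N par. snd r = 1}" (is "_ = ?A \<union> ?B")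
    by auto
  have "sum h (pos_roots N par) = sum h ?A + sum h ?B"
    by (subst split, rule sum.union_disjoint) (use finr in auto)
  also have "sum h ?A = (\<Sum>(\<alpha>, p)\<in>?A. \<alpha> k)"
    by (rule sum.cong) (auto simp: h_def parity_sign_def)
  also have "sum h ?B = (\<Sum>(\<alpha>, p)\<in>?B. - \<alpha> k)"
    by (rule sum.cong) (auto simp: h_def parity_sign_def)
  also have "\<dots> = - (\<Sum>(\<alpha>, p)\<in>?B. \<alpha> k)"
    by (simp add: sum_negf case_prod_unfold)
  finally have "2 * rho N par k = sum h (pos_roots N par)"
    unfolding rho_def by simp
  also have "\<dots> = sum h (f ` pairs N) + sum h (g ` longs N par)"
    unfolding roots by (rule sum.union_disjoint) (use fin disj in auto)
  also have "sum h (f ` pairs N) = sum (h \<circ> f) (pairs N)"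
    by (rule sum.reindex[OF inj_f])
  also have "sum h (g ` longs N par) = sum (h \<circ> g) (longs N par)"
    by (rule sum.reindex[OF inj_g])
  finally show ?thesis
    by (simp add: h_def f_def g_def rt_def o_def case_prod_unfold parity_sign_def)
qed

private lemma even_count:
  assumes "\<not> B" "\<not> (A \<and> C)" "\<not> (A \<and> D)" "\<not> (C \<and> D)"
  shows "even ((if P then 1 else - 1) * (of_bool A - of_bool B - (of_bool C - of_bool D))
    - of_bool (A \<or> C \<or> D) :: int)"
  using assms by (cases P; cases A; cases C; cases D; simp)

private lemma two_rho_parity:
  assumes k: "k \<in> {1..N div 2}"
  shows "2 * rho N par k - of_nat N \<in> ev"
proof -
  let ?S = "{p \<in> pairs N. fst p = k \<or> snd p = k \<or> snd p = N + 1 - k}"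
  have S: "?S = {k} \<times> {k<..<N + 1 - k} \<union> {1..<k} \<times> {k, N + 1 - k}"
    using k by (auto simp: pairs_def)
  have "card ?S = card ({k} \<times> {k<..<N + 1 - k}) + card ({1..<k} \<times> {k, N + 1 - k})"
    unfolding S by (rule card_Un_disjoint) auto
  also have "\<dots> = (N - 2 * k) + (k - 1) * 2"
    using k by (simp only: card_cartesian_product) (auto simp: card_insert_if)
  also have "\<dots> = N - 2" using k by auto
  finally have cardS: "card ?S = N - 2" .
  have N2: "N \<ge> 2" using k by auto
  have "(\<Sum>p\<in>pairs N. of_bool (fst p = k \<or> snd p = k \<or> snd p = N + 1 - k) :: rat) = of_nat (card ?S)"
    using finite_pairs[of N] by (simp add: of_bool_def sum.If_cases Int_def conj_commute)
  then have cnt: "(\<Sum>p\<in>pairs N. of_bool (fst p = k \<or> snd p = k \<or> snd p = N + 1 - k) :: rat)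
      = of_nat N - 2"
    using cardS N2 by (simp add: of_nat_diff)
  have odd_part: "parity_sign (par a + par b) * (eps N a k - eps N b k)
        - of_bool (a = k \<or> b = k \<or> b = N + 1 - k) \<in> ev" if "(a, b) \<in> pairs N" for a b
  proof -
    note p = pairsD[OF that]
    define z :: int where "z = parity_sign (par a + par b) *
        (of_bool (a = k) - of_bool (a = N + 1 - k) - (of_bool (b = k) - of_bool (b = N + 1 - k)))
        - of_bool (a = k \<or> b = k \<or> b = N + 1 - k)"
    have "a \<noteq> N + 1 - k" using p(3) k by auto
    moreover have "\<not> (a = k \<and> b = k)" "\<not> (a = k \<and> b = N + 1 - k)" "\<not> (b = k \<and> b = N + 1 - k)"
      using p k by auto
    ultimately have "even z" unfolding z_def parity_sign_def by (intro even_count)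
    moreover have "parity_sign (par a + par b) * (eps N a k - eps N b k)
        - of_bool (a = k \<or> b = k \<or> b = N + 1 - k) = of_int z"
      unfolding z_def eps_apply[OF p(1) k] eps_apply[OF p(2) k]
      by (simp only: of_int_diff of_int_mult of_int_of_bool of_int_parity_sign)
    ultimately show ?thesis by (simp only: ev_of_int)
  qed
  have A: "(\<Sum>p\<in>pairs N. parity_sign (par (fst p) + par (snd p)) * (eps N (fst p) k - eps N (snd p) k)
      - of_bool (fst p = k \<or> snd p = k \<or> snd p = N + 1 - k)) \<in> ev"
  proof (rule ev_sum)
    fix p assume "p \<in> pairs N"
    then show "parity_sign (par (fst p) + par (snd p)) * (eps N (fst p) k - eps N (snd p) k)
      - of_bool (fst p = k \<or> snd p = k \<or> snd p = N + 1 - k) \<in> ev"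
      using odd_part[of "fst p" "snd p"] by simp
  qed
  have B: "(\<Sum>a\<in>longs N par. 2 * eps N a k) \<in> ev"
  proof (rule ev_sum)
    fix a
    obtain z where "eps N a k = of_int z" by (rule Ints_cases[OF eps_Ints[of N a k]])
    then show "2 * eps N a k \<in> ev" unfolding ev_def by (intro range_eqI[of _ _ z]) simp
  qed
  have two: "(- 2 :: rat) \<in> ev" using ev_of_int[of "- 2"] by simp
  have "2 * rho N par k - of_nat N =
     (\<Sum>p\<in>pairs N. parity_sign (par (fst p) + par (snd p)) * (eps N (fst p) k - eps N (snd p) k)
      - of_bool (fst p = k \<or> snd p = k \<or> snd p = N + 1 - k))
     + (\<Sum>a\<in>longs N par. 2 * eps N a k) + (- 2)"
    unfolding two_rho sum_subtractf cnt by (simp add: case_prod_unfold)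
  also have "\<dots> \<in> ev" by (intro ev_add A B two)
  finally show ?thesis .
qed

private lemma weight_form_eps:
  assumes i: "i \<in> {1..N}"
  shows "weight_form N par x (eps N i) =
    (if i \<le> N div 2 then parity_sign (par i) * x i
     else if N + 1 - i \<le> N div 2 then - parity_sign (par (N + 1 - i)) * x (N + 1 - i) else 0)"
proof -
  have "weight_form N par x (eps N i) = (\<Sum>k = 1..N div 2.
      (if k = i then parity_sign (par k) * x k else 0)
      - (if k = N + 1 - i then parity_sign (par k) * x k else 0))"
    unfolding weight_form_def
  proof (rule sum.cong[OF refl])
    fix k assume k: "k \<in> {1..N div 2}"
    then have "(i = N + 1 - k) = (k = N + 1 - i)" using i by auto
    then show "parity_sign (par k) * x k * eps N i k =
      (if k = i then parity_sign (par k) * x k else 0)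
      - (if k = N + 1 - i then parity_sign (par k) * x k else 0)"
      unfolding eps_apply[OF i k] by (auto simp: of_bool_def)
  qed
  also have "\<dots> = (if i \<in> {1..N div 2} then parity_sign (par i) * x i else 0)
      - (if N + 1 - i \<in> {1..N div 2} then parity_sign (par (N + 1 - i)) * x (N + 1 - i) else 0)"
    unfolding sum_subtractf by (simp only: sum.delta finite_atLeastAtMost)
  also have "(i \<in> {1..N div 2}) = (i \<le> N div 2)" using i by simp
  also have "(N + 1 - i \<in> {1..N div 2}) = (N + 1 - i \<le> N div 2)" using i by auto
  finally have eq: "weight_form N par x (eps N i) =
      (if i \<le> N div 2 then parity_sign (par i) * x i else 0)
      - (if N + 1 - i \<le> N div 2 then parity_sign (par (N + 1 - i)) * x (N + 1 - i) else 0)" .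
  have "\<not> (i \<le> N div 2 \<and> N + 1 - i \<le> N div 2)" using i by auto
  then show ?thesis unfolding eq by (cases "i \<le> N div 2") simp_all
qed

private lemma exponent_half:
  assumes i: "i \<in> {1..N}"
  shows "2 * weight_form N par (rho N par) (eps N i) - weight_form N par (eps N i) (eps N i)
    - (of_nat N - 1) \<in> ev"
proof -
  have key: "2 * (c * rho N par k) - d - (of_nat N - 1) \<in> ev"
    if k: "k \<in> {1..N div 2}" and c: "c = 1 \<or> c = - 1" and d: "d = 1 \<or> d = - 1" for c d :: rat and k
  proof -
    have r: "2 * rho N par k - of_nat N \<in> ev" by (rule two_rho_parity[OF k])
    have s: "of_nat N + of_nat N \<in> ev" using ev_of_int[of "int N + int N"] by simp
    have d': "1 - d \<in> ev" using d ev_of_int[of 0] ev_of_int[of 2] by auto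
    from c show ?thesis
    proof
      assume "c = 1"
      then show ?thesis using ev_add[OF r d'] by (simp add: algebra_simps)
    next
      assume "c = - 1"
      then show ?thesis using ev_add[OF ev_diff[OF ev_uminus[OF r] s] d'] by (simp add: algebra_simps)
    qed
  qed
  have sg: "parity_sign p = (1::rat) \<or> parity_sign p = (- 1::rat)" for p
    by (simp add: parity_sign_def)
  consider "i \<le> N div 2" | "\<not> i \<le> N div 2" "N + 1 - i \<le> N div 2"
    | "\<not> i \<le> N div 2" "\<not> N + 1 - i \<le> N div 2" by blast
  then show ?thesis
  proof cases
    case 1
    then have e: "eps N i i = 1" using i by (simp add: eps_def)
    show ?thesis using key[of i "parity_sign (par i)" "parity_sign (par i)"] 1 i sg
      by (simp add: weight_form_eps e)
  next
    case 2
    have sg': "- parity_sign p = (1::rat) \<or> - parity_sign p = (- 1::rat)" for p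
      by (simp add: parity_sign_def)
    from 2 have e: "eps N i (Suc N - i) = - 1" using i by (simp add: eps_def dual_index_def)
    show ?thesis
      using key[of "N + 1 - i" "- parity_sign (par (N + 1 - i))" "parity_sign (par (N + 1 - i))"]
        2 i sg' sg[of "par (N + 1 - i)"]
      by (simp add: weight_form_eps e)
  next
    case 3
    then have "odd N" using i by (auto elim!: evenE)
    then have "of_int (1 - int N) \<in> ev" by (intro ev_of_int) simp
    then show ?thesis using 3 i by (simp add: weight_form_eps)
  qed
qed

lemma R_exponent_Ints:
  assumes "i \<in> {1..N}" "j \<in> {1..N}"
  shows "R_exponent N par i j \<in> \<int>"
proof -
  have lin: "2 * ((a - b) - (1 / 2) * c + (1 / 2) * d) = (2 * a - c - e) - (2 * b - d - e)"
    for a b c d e :: rat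
    by (simp add: algebra_simps)
  have wf: "weight_form N par x (\<lambda>k. eps N i k - eps N j k)
      = weight_form N par x (eps N i) - weight_form N par x (eps N j)" for x
    by (simp add: weight_form_def right_diff_distrib sum_subtractf)
  have "2 * R_exponent N par i j =
     (2 * weight_form N par (rho N par) (eps N i) - weight_form N par (eps N i) (eps N i)
        - (of_nat N - 1))
     - (2 * weight_form N par (rho N par) (eps N j) - weight_form N par (eps N j) (eps N j)
        - (of_nat N - 1))"
    unfolding R_exponent_def wf by (rule lin)
  also have "\<dots> \<in> ev" by (intro ev_diff exponent_half assms)
  finally obtain z where "2 * R_exponent N par i j = 2 * of_int z" unfolding ev_def by blast
  then have "R_exponent N par i j = of_int z" by simp
  then show ?thesis by simp
qed

end

section \<open>Matrix units and the R-matrix\<close>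

definition End_V :: "nat \<Rightarrow> (nat \<Rightarrow> bit) \<Rightarrow> (bit, nat \<times> nat) based_algebra" where
  "End_V N par =
     \<lparr>basis = {1..N} \<times> {1..N},
      bdeg = (\<lambda>(i, j). par i + par j),
      bprod = (\<lambda>(i, j) (k, l). if j = k then Poly_Mapping.single (i, l) 1 else 0),
      bunit = (\<Sum>i = 1..N. Poly_Mapping.single (i, i) 1)\<rparr>"

definition Emat :: "nat \<Rightarrow> nat \<Rightarrow> (nat \<times> nat \<Rightarrow>\<^sub>0 ratfun)" where
  "Emat i j = Poly_Mapping.single (i, j) 1"

definition R_matrix ::
  "nat \<Rightarrow> (nat \<Rightarrow> bit) \<Rightarrow> (nat \<Rightarrow> int) \<Rightarrow> ((nat \<times> nat) \<times> (nat \<times> nat) \<Rightarrow>\<^sub>0 ratfun)" where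
  "R_matrix N par \<theta> =
     scale (inverse qvar)
       (\<Sum>i = 1..N. \<Sum>j = 1..N.
          scale (qpow (- weight_form N par (eps N i) (eps N j))) (Emat i i \<otimes>\<^sub>p Emat j j))
     - scale ((qvar - inverse qvar) * inverse qvar)
       (\<Sum>(i, j)\<in>{(i, j). 1 \<le> i \<and> i < j \<and> j \<le> N}.
          scale (parity_sign (par j))
            (Emat i j \<otimes>\<^sub>p
              (Emat j i - scale (parity_sign (par j * (par i + par j)) * of_int (\<theta> i * \<theta> j)
                              * qpow (R_exponent N par i j))
                         (Emat (dual_index N i) (dual_index N j)))))"


section \<open>The RLL superalgebras\<close>

datatype pm = Plus | Minus

text \<open>\<open>Gen Plus i j\<close> and \<open>Gen Minus i j\<close> stand for \<open>l\<^sup>+\<^sub>i\<^sub>j\<close> and \<open>l\<^sup>-\<^sub>i\<^sub>j\<close>; the generators of the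
  second kind have \<open>i \<ge> j\<close>.\<close>

datatype gen = Gen pm nat nat

definition gens :: "nat \<Rightarrow> gen set" where
  "gens N = {Gen Plus i j | i j. 1 \<le> i \<and> i \<le> j \<and> j \<le> N}
          \<union> {Gen Minus j i | i j. 1 \<le> i \<and> i \<le> j \<and> j \<le> N}"

fun gen_parity :: "(nat \<Rightarrow> bit) \<Rightarrow> gen \<Rightarrow> bit" where
  "gen_parity par (Gen s i j) = par i + par j"

definition free_algebra :: "nat \<Rightarrow> (nat \<Rightarrow> bit) \<Rightarrow> (bit, gen list) based_algebra" where
  "free_algebra N par =
     \<lparr>basis = lists (gens N),
      bdeg = (\<lambda>w. sum_list (map (gen_parity par) w)),
      bprod = (\<lambda>v w. Poly_Mapping.single (v @ w) 1),
      bunit = Poly_Mapping.single [] 1\<rparr>"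

definition lgen :: "nat \<Rightarrow> pm \<Rightarrow> nat \<Rightarrow> nat \<Rightarrow> (gen list \<Rightarrow>\<^sub>0 ratfun)" where
  "lgen N s i j = (if Gen s i j \<in> gens N then Poly_Mapping.single [Gen s i j] 1 else 0)"

type_synonym mat2 = "gen list \<times> (nat \<times> nat) \<times> (nat \<times> nat) \<Rightarrow>\<^sub>0 ratfun"

definition T_End2 ::
  "(bit \<times> bit \<Rightarrow> bit \<times> bit \<Rightarrow> ratfun) \<Rightarrow> nat \<Rightarrow> (nat \<Rightarrow> bit)
     \<Rightarrow> (bit \<times> bit, gen list \<times> (nat \<times> nat) \<times> (nat \<times> nat)) based_algebra" where
  "T_End2 \<beta> N par =
     tensor_algebra \<beta> (regrade (\<lambda>d. (d, 0)) (free_algebra N par))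
       (tensor_algebra \<beta> (regrade (\<lambda>d. (0, d)) (End_V N par)) (regrade (\<lambda>d. (0, d)) (End_V N par)))"

definition L1 :: "nat \<Rightarrow> (nat \<Rightarrow> bit) \<Rightarrow> pm \<Rightarrow> mat2" where
  "L1 N par s = (\<Sum>i = 1..N. \<Sum>j = 1..N. lgen N s i j \<otimes>\<^sub>p Emat i j \<otimes>\<^sub>p bunit (End_V N par))"

definition L2 :: "nat \<Rightarrow> (nat \<Rightarrow> bit) \<Rightarrow> pm \<Rightarrow> mat2" where
  "L2 N par s = (\<Sum>i = 1..N. \<Sum>j = 1..N. lgen N s i j \<otimes>\<^sub>p bunit (End_V N par) \<otimes>\<^sub>p Emat i j)"

definition R12 :: "nat \<Rightarrow> (nat \<Rightarrow> bit) \<Rightarrow> (nat \<Rightarrow> int) \<Rightarrow> mat2" where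
  "R12 N par \<theta> = bunit (free_algebra N par) \<otimes>\<^sub>p R_matrix N par \<theta>"

text \<open>\<open>R\<^sub>1\<^sub>2 L\<^sup>s\<^sub>1 L\<^sup>t\<^sub>2 - L\<^sup>t\<^sub>2 L\<^sup>s\<^sub>1 R\<^sub>1\<^sub>2\<close>\<close>

definition RLL_defect ::
  "(bit \<times> bit \<Rightarrow> bit \<times> bit \<Rightarrow> ratfun) \<Rightarrow> nat \<Rightarrow> (nat \<Rightarrow> bit) \<Rightarrow> (nat \<Rightarrow> int)
     \<Rightarrow> pm \<Rightarrow> pm \<Rightarrow> mat2" where
  "RLL_defect \<beta> N par \<theta> s t =
     (let mul = alg_mult (T_End2 \<beta> N par)
      in mul (mul (R12 N par \<theta>) (L1 N par s)) (L2 N par t)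
         - mul (mul (L2 N par t) (L1 N par s)) (R12 N par \<theta>))"

text \<open>The coefficient in the first tensor factor along a basis element of the second.\<close>

definition coefficient :: "('a \<times> 'b \<Rightarrow>\<^sub>0 ratfun) \<Rightarrow> 'b \<Rightarrow> ('a \<Rightarrow>\<^sub>0 ratfun)" where
  "coefficient Y e =
     (\<Sum>(a, b)\<in>{p \<in> Poly_Mapping.keys Y. snd p = e}.
        Poly_Mapping.single a (Poly_Mapping.lookup Y (a, b)))"

definition RLL_relations ::
  "(bit \<times> bit \<Rightarrow> bit \<times> bit \<Rightarrow> ratfun) \<Rightarrow> nat \<Rightarrow> (nat \<Rightarrow> bit) \<Rightarrow> (nat \<Rightarrow> int)
     \<Rightarrow> (gen list \<Rightarrow>\<^sub>0 ratfun) set" where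
  "RLL_relations \<beta> N par \<theta> =
     (let T = free_algebra N par in
       {alg_mult T (lgen N Plus i i) (lgen N Minus i i) - bunit T | i. i \<in> {1..N}}
     \<union> {alg_mult T (lgen N Minus i i) (lgen N Plus i i) - bunit T | i. i \<in> {1..N}}
     \<union> {coefficient (RLL_defect \<beta> N par \<theta> s t) e | s t e.
          (s, t) \<in> {(Plus, Plus), (Minus, Minus), (Plus, Minus)} \<and>
          e \<in> ({1..N} \<times> {1..N}) \<times> ({1..N} \<times> {1..N})})"

definition RLL_ideal ::
  "(bit \<times> bit \<Rightarrow> bit \<times> bit \<Rightarrow> ratfun) \<Rightarrow> nat \<Rightarrow> (nat \<Rightarrow> bit) \<Rightarrow> (nat \<Rightarrow> int)
     \<Rightarrow> (gen list \<Rightarrow>\<^sub>0 ratfun) set" where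
  "RLL_ideal \<beta> N par \<theta> =
     genideal (superalgebra_of (free_algebra N par)) (RLL_relations \<beta> N par \<theta>)"

definition RLL_superalgebra ::
  "(bit \<times> bit \<Rightarrow> bit \<times> bit \<Rightarrow> ratfun) \<Rightarrow> nat \<Rightarrow> (nat \<Rightarrow> bit) \<Rightarrow> (nat \<Rightarrow> int)
     \<Rightarrow> (ratfun, (gen list \<Rightarrow>\<^sub>0 ratfun) set) superalgebra" where
  "RLL_superalgebra \<beta> N par \<theta> =
     quotient_superalgebra (superalgebra_of (free_algebra N par)) (RLL_ideal \<beta> N par \<theta>)"

text \<open>The class of the generator \<open>l\<^sup>s\<^sub>i\<^sub>j\<close> in the quotient.\<close>

definition RLL_gen ::
  "(bit \<times> bit \<Rightarrow> bit \<times> bit \<Rightarrow> ratfun) \<Rightarrow> nat \<Rightarrow> (nat \<Rightarrow> bit) \<Rightarrow> (nat \<Rightarrow> int)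
     \<Rightarrow> pm \<Rightarrow> nat \<Rightarrow> nat \<Rightarrow> (gen list \<Rightarrow>\<^sub>0 ratfun) set" where
  "RLL_gen \<beta> N par \<theta> s i j =
     RLL_ideal \<beta> N par \<theta> +>\<^bsub>superalgebra_of (free_algebra N par)\<^esub> lgen N s i j"

text \<open>The extended orthosymplectic RLL superalgebra \<open>U(R)\<close> and its twisted version.\<close>

definition U_RLL :: "nat \<Rightarrow> (nat \<Rightarrow> bit) \<Rightarrow> (nat \<Rightarrow> int)
    \<Rightarrow> (ratfun, (gen list \<Rightarrow>\<^sub>0 ratfun) set) superalgebra" where
  "U_RLL = RLL_superalgebra beta_total"

definition U_RLL_twisted :: "nat \<Rightarrow> (nat \<Rightarrow> bit) \<Rightarrow> (nat \<Rightarrow> int)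
    \<Rightarrow> (ratfun, (gen list \<Rightarrow>\<^sub>0 ratfun) set) superalgebra" where
  "U_RLL_twisted = RLL_superalgebra beta_split"

end

theory Submission
  imports Defs
begin

text \<open>
  Let \<open>T\<close> be the free superalgebra on the generators, so that the two RLL superalgebras are quotients
  of \<open>T\<close> by two ideals. The isomorphism is already visible on \<open>T\<close>: multiply every word by a sign,
  namely \<open>-1\<close> to the number of pairs of odd letters in it. This \<open>word_sign\<close> satisfies
  \<open>\<sigma>(vw) = \<zeta>(|v|, |w|) \<sigma>(v) \<sigma>(w)\<close>; it exhibits the cocycle \<open>\<zeta>\<close>, pulled back to words, as a
  coboundary. Hence rescaling words by \<open>\<sigma>\<close> is an isomorphism from \<open>T\<close> onto its twist that fixes all
  generators (\<open>superalgebra_iso_reorder\<close>).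

  Such an isomorphism passes to quotients by ideals generated by homogeneous elements. These
  ideals are graded (\<open>graded_ideal_genideal\<close>), a graded subgroup is an ideal of an algebra exactly if
  it is an ideal of the twist (\<open>graded_ideal_twist_iff\<close>), because the two products differ by nonzero
  scalars on homogeneous elements, and the twist of a graded quotient is the quotient of the twist
  (\<open>twist_quotient_mult\<close>, \<open>superalgebra_iso_quotient\<close>).

  It remains to see that rescaling carries the defining relations of the first quotient to those of
  the second (\<open>reorder_relations\<close>). The two bicharacters give the same product on the two matrix
  factors and differ only in the sign \<open>\<zeta>(|b|, |a'|)\<close> that \<open>\<beta>\<close> attaches to moving a matrix \<open>b\<close> past an
  element \<open>a'\<close> of \<open>T\<close>. The tensors \<open>L\<^sub>1\<close>, \<open>L\<^sub>2\<close> and \<open>R\<^sub>1\<^sub>2\<close> are even: they are combinations of basis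
  tensors \<open>a \<otimes> b\<close> with \<open>|a| = |b|\<close>. For such tensors the sign equals \<open>\<zeta>(|a|, |a'|)\<close>, which is the factor
  by which \<open>\<sigma>\<close> fails to be multiplicative. So rescaling the first tensor factor is multiplicative
  on even tensors, from the product with \<open>\<beta>'\<close> to the product with \<open>\<beta>\<close> (\<open>reorder2_mult\<close>). It fixes
  \<open>L\<^sub>1\<close>, \<open>L\<^sub>2\<close> and \<open>R\<^sub>1\<^sub>2\<close>, whose words have at most one letter, and therefore it takes
  \<open>R\<^sub>1\<^sub>2 L\<^sub>1 L\<^sub>2 - L\<^sub>2 L\<^sub>1 R\<^sub>1\<^sub>2\<close> computed with \<open>\<beta>'\<close> to the same expression computed with \<open>\<beta>\<close>, one
  coefficient at a time.
\<close>

section \<open>Superalgebras and homogeneous parts\<close>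

text \<open>Additive inverses are multiples by \<open>-1\<close>, so closure under sums and scalars makes the
  homogeneous components submodules; their sum is direct as soon as they meet in zero.\<close>

lemma superalgebraI:
  fixes A :: "('k::field, 'a, 'm) superalgebra_scheme" (structure)
  assumes "ring A"
    and smult_closed: "\<And>c x. x \<in> carrier A \<Longrightarrow> c \<odot> x \<in> carrier A"
    and smult_add_left: "\<And>c d x. x \<in> carrier A \<Longrightarrow> (c + d) \<odot> x = c \<odot> x \<oplus> d \<odot> x"
    and smult_add_right:
      "\<And>c x y. \<lbrakk>x \<in> carrier A; y \<in> carrier A\<rbrakk> \<Longrightarrow> c \<odot> (x \<oplus> y) = c \<odot> x \<oplus> c \<odot> y"
    and smult_smult: "\<And>c d x. x \<in> carrier A \<Longrightarrow> (c * d) \<odot> x = c \<odot> (d \<odot> x)"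
    and smult_one: "\<And>x. x \<in> carrier A \<Longrightarrow> 1 \<odot> x = x"
    and mult_left:
      "\<And>c x y. \<lbrakk>x \<in> carrier A; y \<in> carrier A\<rbrakk> \<Longrightarrow> (c \<odot> x) \<otimes> y = c \<odot> (x \<otimes> y)"
    and mult_right:
      "\<And>c x y. \<lbrakk>x \<in> carrier A; y \<in> carrier A\<rbrakk> \<Longrightarrow> x \<otimes> (c \<odot> y) = c \<odot> (x \<otimes> y)"
    and homog_subset: "\<And>d. homog A d \<subseteq> carrier A"
    and homog_zero: "\<And>d. \<zero> \<in> homog A d"
    and homog_add: "\<And>d x y. \<lbrakk>x \<in> homog A d; y \<in> homog A d\<rbrakk> \<Longrightarrow> x \<oplus> y \<in> homog A d"
    and homog_smult: "\<And>d c x. x \<in> homog A d \<Longrightarrow> c \<odot> x \<in> homog A d"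
    and homog_sum: "\<And>x. x \<in> carrier A \<Longrightarrow> \<exists>y\<in>homog A 0. \<exists>z\<in>homog A 1. x = y \<oplus> z"
    and homog_disjoint: "\<And>x. \<lbrakk>x \<in> homog A 0; x \<in> homog A 1\<rbrakk> \<Longrightarrow> x = \<zero>"
    and homog_one: "\<one> \<in> homog A 0"
    and homog_mult:
      "\<And>d e x y. \<lbrakk>x \<in> homog A d; y \<in> homog A e\<rbrakk> \<Longrightarrow> x \<otimes> y \<in> homog A (d + e)"
  shows "superalgebra A"
proof -
  interpret ring A by fact
  interpret M: module "ring_of_type_algebra :: 'k ring" A
    by (rule moduleI)
      (auto simp: ring_of_type_algebra_def smult_closed smult_add_left smult_add_right smult_smult
        smult_one is_abelian_group intro: cring_from_type_algebra[unfolded ring_of_type_algebra_def])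
  have neg: "\<ominus> x = (- 1) \<odot> x" if "x \<in> carrier A" for x
  proof (rule minus_equality)
    show "(- 1) \<odot> x \<oplus> x = \<zero>"
      using smult_add_left[OF that, of "- 1" 1] M.smult_l_null[OF that]
      by (simp add: smult_one that ring_of_type_algebra_def)
  qed (simp_all add: that smult_closed)
  have homog_minus: "\<ominus> x \<in> homog A d" if "x \<in> homog A d" for x d
    using neg homog_subset homog_smult that by (metis subsetD)
  show ?thesis
  proof (intro superalgebra.intro superalgebra_axioms.intro)
    show "ring A" by (rule ring_axioms)
    show "module (ring_of_type_algebra :: 'k ring) A" by unfold_locales
    show "submodule (homog A d) (ring_of_type_algebra :: 'k ring) A" for d
      by (rule M.submoduleI)
        (use homog_subset in \<open>auto simp: homog_zero homog_add homog_smult homog_minus\<close>)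
    show "\<exists>!(y, z). y \<in> homog A 0 \<and> z \<in> homog A 1 \<and> x = y \<oplus> z" if x: "x \<in> carrier A" for x
    proof -
      obtain y z where yz: "y \<in> homog A 0" "z \<in> homog A 1" "x = y \<oplus> z"
        using homog_sum[OF x] by blast
      show ?thesis
      proof (rule ex1I[of _ "(y, z)"])
        show "case (y, z) of (y, z) \<Rightarrow> y \<in> homog A 0 \<and> z \<in> homog A 1 \<and> x = y \<oplus> z"
          using yz by simp
      next
        fix p assume "case p of (y, z) \<Rightarrow> y \<in> homog A 0 \<and> z \<in> homog A 1 \<and> x = y \<oplus> z"
        then obtain u v where p: "p = (u, v)" and uv: "u \<in> homog A 0" "v \<in> homog A 1" "x = u \<oplus> v"
          by (cases p) auto
        have car: "y \<in> carrier A" "z \<in> carrier A" "u \<in> carrier A" "v \<in> carrier A"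
          using yz uv homog_subset by auto
        have yu: "y \<oplus> z = u \<oplus> v" using yz uv by simp
        have "u \<ominus> y = (u \<oplus> v) \<ominus> (y \<oplus> v)" using car by algebra
        also have "\<dots> = z \<ominus> v" unfolding yu[symmetric] using car by algebra
        finally have eq: "u \<ominus> y = z \<ominus> v" .
        have "u \<ominus> y \<in> homog A 0" using uv yz by (simp add: a_minus_def homog_add homog_minus)
        moreover have "u \<ominus> y \<in> homog A 1"
          unfolding eq using uv yz by (simp add: a_minus_def homog_add homog_minus)
        ultimately have "u \<ominus> y = \<zero>" by (rule homog_disjoint)
        moreover from this have "z \<ominus> v = \<zero>" using eq by simp
        ultimately show "p = (y, z)" using car p by (simp add: r_right_minus_eq)
      qed
    qed
  qed (use mult_left mult_right homog_one homog_mult in auto)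
qed

context superalgebra
begin

abbreviation part :: "bit \<Rightarrow> 'a \<Rightarrow> 'a" where
  "part \<equiv> homog_part A"

lemma smult_closed [simp, intro]: "x \<in> carrier A \<Longrightarrow> c \<odot> x \<in> carrier A"
  using module.smult_closed[OF module, of c x] by (simp add: ring_of_type_algebra_def)

lemma smult_add_left: "x \<in> carrier A \<Longrightarrow> (c + d) \<odot> x = c \<odot> x \<oplus> d \<odot> x"
  using module.smult_l_distr[OF module, of c d x] by (simp add: ring_of_type_algebra_def)

lemma smult_add_right: "\<lbrakk>x \<in> carrier A; y \<in> carrier A\<rbrakk> \<Longrightarrow> c \<odot> (x \<oplus> y) = c \<odot> x \<oplus> c \<odot> y"
  using module.smult_r_distr[OF module, of c x y] by (simp add: ring_of_type_algebra_def)

lemma smult_smult: "x \<in> carrier A \<Longrightarrow> c \<odot> (d \<odot> x) = (c * d) \<odot> x"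
  using module.smult_assoc1[OF module, of c d x] by (simp add: ring_of_type_algebra_def)

lemma smult_1 [simp]: "x \<in> carrier A \<Longrightarrow> 1 \<odot> x = x"
  using module.smult_one[OF module, of x] by (simp add: ring_of_type_algebra_def)

lemma smult_zero [simp]: "c \<odot> \<zero> = \<zero>"
  using module.smult_r_null[OF module, of c] by (simp add: ring_of_type_algebra_def)

lemma smult_0 [simp]: "x \<in> carrier A \<Longrightarrow> 0 \<odot> x = \<zero>"
  using module.smult_l_null[OF module, of x] by (simp add: ring_of_type_algebra_def)

lemma minus_eq_smult: "x \<in> carrier A \<Longrightarrow> \<ominus> x = (- 1) \<odot> x"
  using smult_add_left[of x "- 1" 1, symmetric] by (auto intro!: minus_equality)

lemma homog_carrier: "x \<in> homog A d \<Longrightarrow> x \<in> carrier A"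
  using module.submoduleE(1)[OF module homog_submodule] by blast

lemma homog_zero [simp]: "\<zero> \<in> homog A d"
  using subgroup.one_closed[OF submodule.axioms(1)[OF homog_submodule[of d]]] by simp

lemma homog_add: "\<lbrakk>x \<in> homog A d; y \<in> homog A d\<rbrakk> \<Longrightarrow> x \<oplus> y \<in> homog A d"
  using module.submoduleE(5)[OF module homog_submodule] by blast

lemma homog_minus: "x \<in> homog A d \<Longrightarrow> \<ominus> x \<in> homog A d"
  using module.submoduleE(3)[OF module homog_submodule] by blast

lemma homog_smult: "x \<in> homog A d \<Longrightarrow> c \<odot> x \<in> homog A d"
  using submodule.smult_closed[OF homog_submodule, of c x d] by (simp add: ring_of_type_algebra_def)

lemma part_eqI:
  assumes y: "y \<in> homog A d" and z: "z \<in> homog A (d + 1)" and x: "x = y \<oplus> z"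
  shows "part d x = y"
  unfolding homog_part_def
proof (rule the_equality)
  show "y \<in> homog A d \<and> (\<exists>z\<in>homog A (d + 1). x = y \<oplus> z)" using assms by blast
next
  fix y' assume "y' \<in> homog A d \<and> (\<exists>z\<in>homog A (d + 1). x = y' \<oplus> z)"
  then obtain z' where z': "y' \<in> homog A d" "z' \<in> homog A (d + 1)" "x = y' \<oplus> z'" by blast
  have car: "y \<in> carrier A" "z \<in> carrier A" "y' \<in> carrier A" "z' \<in> carrier A"
    using assms z' homog_carrier by auto
  then have "x \<in> carrier A" using x by simp
  from homog_decomposition[OF this] have uniq: "p = p'"
    if "case p of (y, z) \<Rightarrow> y \<in> homog A 0 \<and> z \<in> homog A 1 \<and> x = y \<oplus> z"
      "case p' of (y, z) \<Rightarrow> y \<in> homog A 0 \<and> z \<in> homog A 1 \<and> x = y \<oplus> z" for p p'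
    using that by blast
  show "y' = y"
  proof (cases d)
    case zero
    then show ?thesis using uniq[of "(y, z)" "(y', z')"] assms z' by simp
  next
    case one
    then show ?thesis using uniq[of "(z, y)" "(z', y')"] assms z' car by (simp add: a_comm)
  qed
qed

lemma
  assumes "x \<in> carrier A"
  shows part_homog: "part d x \<in> homog A d"
    and part_sum: "part d x \<oplus> part (d + 1) x = x"
proof -
  from homog_decomposition[OF assms] obtain y z where yz:
    "y \<in> homog A 0" "z \<in> homog A 1" "x = y \<oplus> z" by blast
  then have zy: "x = z \<oplus> y" by (simp add: a_comm homog_carrier)
  have p: "part 0 x = y" "part 1 x = z"
    using part_eqI[of y 0 z x] part_eqI[of z 1 y x] yz zy by simp_all
  show "part d x \<in> homog A d" "part d x \<oplus> part (d + 1) x = x"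
    using p yz zy by (cases d; simp)+
qed

lemma part_closed [simp, intro]: "x \<in> carrier A \<Longrightarrow> part d x \<in> carrier A"
  using part_homog homog_carrier by blast

lemma part_of_homog: "x \<in> homog A e \<Longrightarrow> part d x = (if d = e then x else \<zero>)"
proof (cases "d = e")
  case False
  assume "x \<in> homog A e"
  moreover have "e = d + 1" using False by (cases d; cases e) auto
  ultimately show ?thesis using False by (simp add: part_eqI homog_carrier)
qed (simp add: part_eqI[of x e \<zero> x] homog_carrier)

lemma part_add: "\<lbrakk>x \<in> carrier A; y \<in> carrier A\<rbrakk> \<Longrightarrow> part d (x \<oplus> y) = part d x \<oplus> part d y"
proof (rule part_eqI)
  assume xy: "x \<in> carrier A" "y \<in> carrier A"
  show "part d x \<oplus> part d y \<in> homog A d" using xy by (simp add: homog_add part_homog)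
  show "part (d + 1) x \<oplus> part (d + 1) y \<in> homog A (d + 1)"
    using xy by (simp add: homog_add part_homog)
  show "x \<oplus> y = part d x \<oplus> part d y \<oplus> (part (d + 1) x \<oplus> part (d + 1) y)"
    using xy part_sum[of x d, symmetric] part_sum[of y d, symmetric]
    by (metis add.m_assoc add.m_lcomm part_closed add.m_closed)
qed

lemma part_smult: "x \<in> carrier A \<Longrightarrow> part d (c \<odot> x) = c \<odot> part d x"
  by (rule part_eqI[of _ _ "c \<odot> part (d + 1) x"])
    (simp_all only: homog_smult part_homog smult_add_right[symmetric] part_sum part_closed)

lemma homog_induct [consumes 1, case_names homog add]:
  assumes "x \<in> carrier A"
    and "\<And>d x. x \<in> homog A d \<Longrightarrow> P x"
    and "\<And>x y. \<lbrakk>x \<in> carrier A; y \<in> carrier A; P x; P y\<rbrakk> \<Longrightarrow> P (x \<oplus> y)"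
  shows "P x"
  using assms(2)[OF part_homog[OF assms(1)]] assms(3) part_sum[OF assms(1), of 0] assms(1)
  by (metis part_closed)

section \<open>Cocycle twists\<close>

lemma twist_mult_eq:
  assumes "x \<in> carrier A" "y \<in> carrier A"
  shows "x \<otimes>\<^bsub>twist \<zeta> A\<^esub> y =
    \<zeta> 0 0 \<odot> (part 0 x \<otimes> part 0 y) \<oplus> (\<zeta> 0 1 \<odot> (part 0 x \<otimes> part 1 y)
    \<oplus> (\<zeta> 1 0 \<odot> (part 1 x \<otimes> part 0 y) \<oplus> \<zeta> 1 1 \<odot> (part 1 x \<otimes> part 1 y)))"
proof -
  have "{0, 1} \<times> {0, 1 :: bit} = {(0, 0), (0, 1), (1, 0), (1, 1)}" by auto
  then show ?thesis using assms by (simp add: twist_def)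
qed

lemma twist_mult_homog:
  assumes "x \<in> homog A d" "y \<in> homog A e"
  shows "x \<otimes>\<^bsub>twist \<zeta> A\<^esub> y = \<zeta> d e \<odot> (x \<otimes> y)"
  using assms homog_carrier[OF assms(1)] homog_carrier[OF assms(2)]
  by (cases d; cases e) (simp_all add: twist_mult_eq part_of_homog)

lemma twist_simps [simp]:
  "carrier (twist \<zeta> A) = carrier A" "one (twist \<zeta> A) = \<one>" "zero (twist \<zeta> A) = \<zero>"
  "add (twist \<zeta> A) = add A" "smult (twist \<zeta> A) = smult A" "homog (twist \<zeta> A) = homog A"
  by (simp_all add: twist_def)

lemma twist_mult_closed:
  "\<lbrakk>x \<in> carrier A; y \<in> carrier A\<rbrakk> \<Longrightarrow> x \<otimes>\<^bsub>twist \<zeta> A\<^esub> y \<in> carrier A"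
  by (simp add: twist_mult_eq)

lemma twist_distrib:
  assumes "x \<in> carrier A" "y \<in> carrier A" "z \<in> carrier A"
  shows "(x \<oplus> y) \<otimes>\<^bsub>twist \<zeta> A\<^esub> z = x \<otimes>\<^bsub>twist \<zeta> A\<^esub> z \<oplus> y \<otimes>\<^bsub>twist \<zeta> A\<^esub> z"
    and "z \<otimes>\<^bsub>twist \<zeta> A\<^esub> (x \<oplus> y) = z \<otimes>\<^bsub>twist \<zeta> A\<^esub> x \<oplus> z \<otimes>\<^bsub>twist \<zeta> A\<^esub> y"
  using assms by (simp_all add: twist_mult_eq part_add l_distr r_distr smult_add_right a_ac)

lemma twist_smult:
  assumes "x \<in> carrier A" "y \<in> carrier A"
  shows "(c \<odot> x) \<otimes>\<^bsub>twist \<zeta> A\<^esub> y = c \<odot> (x \<otimes>\<^bsub>twist \<zeta> A\<^esub> y)"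
    and "x \<otimes>\<^bsub>twist \<zeta> A\<^esub> (c \<odot> y) = c \<odot> (x \<otimes>\<^bsub>twist \<zeta> A\<^esub> y)"
  using assms
  by (simp_all add: twist_mult_eq part_smult smult_mult_left smult_mult_right smult_add_right
      smult_smult mult.commute)

text \<open>The twisted product is biadditive, so it suffices to compare homogeneous elements, and there
  the two sides differ by the two sides of the cocycle identity.\<close>

lemma twist_assoc:
  assumes "normalized_2cocycle \<zeta>" and xyz: "x \<in> carrier A" "y \<in> carrier A" "z \<in> carrier A"
  shows "x \<otimes>\<^bsub>twist \<zeta> A\<^esub> y \<otimes>\<^bsub>twist \<zeta> A\<^esub> z = x \<otimes>\<^bsub>twist \<zeta> A\<^esub> (y \<otimes>\<^bsub>twist \<zeta> A\<^esub> z)"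
  using xyz(1)
proof (induction x rule: homog_induct)
  case (homog d x)
  have x: "x \<in> carrier A" using homog by (rule homog_carrier)
  show ?case
    using xyz(2)
  proof (induction y rule: homog_induct)
    case (homog e y)
    have y: "y \<in> carrier A" using homog by (rule homog_carrier)
    show ?case
      using xyz(3)
    proof (induction z rule: homog_induct)
      case (homog f z)
      have z: "z \<in> carrier A" using homog by (rule homog_carrier)
      have "x \<otimes>\<^bsub>twist \<zeta> A\<^esub> y \<otimes>\<^bsub>twist \<zeta> A\<^esub> z = (\<zeta> d e * \<zeta> (d + e) f) \<odot> (x \<otimes> y \<otimes> z)"
        using \<open>x \<in> homog A d\<close> \<open>y \<in> homog A e\<close> homog x y z
        by (simp add: twist_mult_homog twist_smult twist_mult_homog[OF homog_mult] smult_smult)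
      also have "\<dots> = (\<zeta> e f * \<zeta> d (e + f)) \<odot> (x \<otimes> y \<otimes> z)"
        using assms(1) by (simp add: normalized_2cocycle_def)
      also have "\<dots> = x \<otimes>\<^bsub>twist \<zeta> A\<^esub> (y \<otimes>\<^bsub>twist \<zeta> A\<^esub> z)"
        using \<open>x \<in> homog A d\<close> \<open>y \<in> homog A e\<close> homog x y z
        by (simp add: twist_mult_homog twist_smult twist_mult_homog[OF _ homog_mult] smult_smult m_assoc)
      finally show ?case .
    qed (use x y in \<open>simp add: twist_distrib twist_mult_closed\<close>)
  qed (use x xyz in \<open>simp add: twist_distrib twist_mult_closed\<close>)
qed (use xyz in \<open>simp add: twist_distrib twist_mult_closed\<close>)

lemma twist_one:
  assumes "normalized_2cocycle \<zeta>" "x \<in> carrier A"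
  shows "\<one> \<otimes>\<^bsub>twist \<zeta> A\<^esub> x = x" "x \<otimes>\<^bsub>twist \<zeta> A\<^esub> \<one> = x"
proof -
  have "\<one> \<otimes>\<^bsub>twist \<zeta> A\<^esub> x = x \<and> x \<otimes>\<^bsub>twist \<zeta> A\<^esub> \<one> = x"
    using assms(2)
  proof (induction x rule: homog_induct)
    case (homog d x)
    then show ?case
      using assms(1) homog_carrier[OF homog]
      by (simp add: twist_mult_homog[OF homog_one] twist_mult_homog[OF _ homog_one] normalized_2cocycle_def)
  qed (simp add: twist_distrib)
  then show "\<one> \<otimes>\<^bsub>twist \<zeta> A\<^esub> x = x" "x \<otimes>\<^bsub>twist \<zeta> A\<^esub> \<one> = x" by auto
qed

lemma superalgebra_twist:
  assumes "normalized_2cocycle \<zeta>"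
  shows "superalgebra (twist \<zeta> A)"
proof (rule superalgebraI)
  show "ring (twist \<zeta> A)"
  proof (rule ringI)
    show "abelian_group (twist \<zeta> A)"
      using is_abelian_group
      by (simp add: abelian_group_def abelian_monoid_def abelian_group_axioms_def)
    show "monoid (twist \<zeta> A)"
      by (rule monoidI) (simp_all add: twist_mult_closed twist_assoc[OF assms] twist_one[OF assms])
  qed (simp_all add: twist_distrib)
  show "\<exists>y\<in>homog (twist \<zeta> A) 0. \<exists>z\<in>homog (twist \<zeta> A) 1. x = y \<oplus>\<^bsub>twist \<zeta> A\<^esub> z"
    if "x \<in> carrier (twist \<zeta> A)" for x
    by (intro bexI[of _ "part 0 x"] bexI[of _ "part 1 x"])
      (use that in \<open>simp_all add: part_homog part_sum[of x 0, simplified]\<close>)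
  show "x = \<zero>\<^bsub>twist \<zeta> A\<^esub>" if "x \<in> homog (twist \<zeta> A) 0" "x \<in> homog (twist \<zeta> A) 1" for x
    using part_of_homog[of x 0 0] part_of_homog[of x 1 0] that by simp
  show "x \<otimes>\<^bsub>twist \<zeta> A\<^esub> y \<in> homog (twist \<zeta> A) (d + e)"
    if "x \<in> homog (twist \<zeta> A) d" "y \<in> homog (twist \<zeta> A) e" for d e x y
    using homog_smult[OF homog_mult] that by (simp only: twist_simps twist_mult_homog)
qed (auto simp: smult_add_left smult_add_right smult_smult twist_smult homog_carrier homog_add
    homog_smult homog_one)

section \<open>Graded ideals\<close>

definition graded_ideal :: "'a set \<Rightarrow> bool" where
  "graded_ideal I \<longleftrightarrow> ideal I A \<and> (\<forall>x\<in>I. \<forall>d. part d x \<in> I)"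

lemma ideal_smult:
  assumes "ideal I A" "x \<in> I"
  shows "c \<odot> x \<in> I"
proof -
  have x: "x \<in> carrier A" using assms by (rule ideal.Icarr)
  have "(c \<odot> \<one>) \<otimes> x \<in> I" using assms by (simp add: ideal.I_l_closed)
  then show ?thesis using x by (simp add: smult_mult_left)
qed

text \<open>Parities of products add, so the part of parity \<open>d\<close> collects the products of parts whose
  parities sum to \<open>d\<close>; in \<open>\<int>\<^sub>2\<close> these are \<open>(0, d)\<close> and \<open>(1, d + 1)\<close>.\<close>

lemma part_mult:
  assumes "x \<in> carrier A" "y \<in> carrier A"
  shows "part d (x \<otimes> y) = part 0 x \<otimes> part d y \<oplus> part 1 x \<otimes> part (d + 1) y"
  using assms(1)
proof (induction x rule: homog_induct)
  case (homog e x)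
  note x = this
  show ?case
    using assms(2)
  proof (induction y rule: homog_induct)
    case (homog f y)
    then show ?case
      using x homog_carrier[OF x] homog_carrier[OF homog] homog_mult[OF x homog]
      by (cases d; cases e; cases f) (simp_all add: part_of_homog)
  qed (use homog_carrier[OF x] in \<open>simp add: part_add r_distr a_ac\<close>)
qed (use assms in \<open>simp add: part_add l_distr a_ac\<close>)

lemma mult_eq_parts:
  assumes "x \<in> carrier A" "y \<in> carrier A"
  shows "x \<otimes> y = part 0 x \<otimes> part 0 y \<oplus> (part 0 x \<otimes> part 1 y
    \<oplus> (part 1 x \<otimes> part 0 y \<oplus> part 1 x \<otimes> part 1 y))"
proof -
  have "x \<otimes> y = (part 0 x \<oplus> part 1 x) \<otimes> (part 0 y \<oplus> part 1 y)"
    using assms part_sum[of x 0] part_sum[of y 0] by simp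
  then show ?thesis using assms by (simp add: l_distr r_distr a_ac)
qed

lemma part_twist [simp]: "homog_part (twist \<zeta> A) = part"
  by (intro ext) (simp add: homog_part_def)

text \<open>On homogeneous elements either product is a nonzero multiple of the other, and a graded
  subgroup absorbs a product once it absorbs the products of all homogeneous parts.\<close>

lemma graded_ideal_twist_iff:
  assumes \<zeta>: "normalized_2cocycle \<zeta>"
  shows "superalgebra.graded_ideal (twist \<zeta> A) I \<longleftrightarrow> graded_ideal I"
proof -
  interpret tw: superalgebra "twist \<zeta> A" by (rule superalgebra_twist[OF \<zeta>])
  have \<zeta>0: "\<zeta> d e \<noteq> 0" for d e using \<zeta> by (simp add: normalized_2cocycle_def)
  have mult: "x \<otimes> y = inverse (\<zeta> d e) \<odot> (x \<otimes>\<^bsub>twist \<zeta> A\<^esub> y)"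
    if "x \<in> homog A d" "y \<in> homog A e" for x y d e
    using that \<zeta>0[of d e] by (simp add: twist_mult_homog homog_carrier smult_smult)
  show ?thesis
  proof
    assume I: "tw.graded_ideal I"
    then have idl: "ideal I (twist \<zeta> A)" and part: "\<And>x d. x \<in> I \<Longrightarrow> part d x \<in> I"
      by (auto simp: tw.graded_ideal_def)
    interpret I: ideal I "twist \<zeta> A" by fact
    have car: "x \<in> carrier A" if "x \<in> I" for x using I.Icarr[OF that] by simp
    have "ideal I A"
    proof (rule idealI)
      show "ring A" by (rule ring_axioms)
      show "subgroup I (add_monoid A)" using I.a_subgroup by simp
      have *: "part d x \<otimes> part e y \<in> I" if "x \<in> carrier A" "y \<in> carrier A" "x \<in> I \<or> y \<in> I" for x y d e
      proof -
        have "part d x \<otimes>\<^bsub>twist \<zeta> A\<^esub> part e y \<in> I"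
          using that part I.I_l_closed I.I_r_closed by auto
        then show ?thesis
          using tw.ideal_smult[OF idl] that by (simp add: mult[of _ d _ e] part_homog)
      qed
      show "x \<otimes> a \<in> I" "a \<otimes> x \<in> I" if "a \<in> I" "x \<in> carrier A" for a x
        using that car[OF that(1)] mult_eq_parts[of x a] mult_eq_parts[of a x] *[of x a] *[of a x] I.a_closed
        by simp_all
    qed
    then show "graded_ideal I" using part by (simp add: graded_ideal_def)
  next
    assume I: "graded_ideal I"
    then have idl: "ideal I A" and part: "\<And>x d. x \<in> I \<Longrightarrow> part d x \<in> I"
      by (auto simp: graded_ideal_def)
    interpret I: ideal I A by fact
    have "ideal I (twist \<zeta> A)"
    proof (rule idealI)
      show "ring (twist \<zeta> A)" by (rule tw.ring_axioms)
      show "subgroup I (add_monoid (twist \<zeta> A))" using I.a_subgroup by simp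
      have *: "\<zeta> d e \<odot> (part d x \<otimes> part e y) \<in> I"
        if "x \<in> carrier A" "y \<in> carrier A" "x \<in> I \<or> y \<in> I" for x y d e
        using that part by (auto intro!: ideal_smult[OF idl] intro: I.I_l_closed I.I_r_closed)
      show "x \<otimes>\<^bsub>twist \<zeta> A\<^esub> a \<in> I" "a \<otimes>\<^bsub>twist \<zeta> A\<^esub> x \<in> I"
        if "a \<in> I" "x \<in> carrier (twist \<zeta> A)" for a x
        using that I.Icarr[OF that(1)] *[of x a] *[of a x]
        by (simp_all add: twist_mult_eq)
    qed
    then show "tw.graded_ideal I" using part by (simp add: tw.graded_ideal_def)
  qed
qed

text \<open>The elements of the generated ideal all of whose parts lie in it form an ideal, which contains
  every homogeneous generator.\<close>

lemma graded_ideal_genideal: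
  assumes S: "S \<subseteq> (\<Union>d. homog A d)"
  shows "graded_ideal (Idl S)"
proof -
  have "S \<subseteq> carrier A" using S homog_carrier by blast
  then have idl: "ideal (Idl S) A" by (rule genideal_ideal)
  interpret I: ideal "Idl S" A by (rule idl)
  define K where "K = {x \<in> Idl S. \<forall>d. part d x \<in> Idl S}"
  have "ideal K A"
  proof (rule idealI)
    show "ring A" by (rule ring_axioms)
    show "subgroup K (add_monoid A)"
    proof (rule add.subgroupI)
      show "K \<subseteq> carrier A" by (auto simp: K_def)
      have "\<zero> \<in> K" using part_of_homog[OF homog_zero[of 0]] I.zero_closed by (simp add: K_def)
      then show "K \<noteq> {}" by blast
      show "\<ominus> x \<in> K" if "x \<in> K" for x
        using that I.Icarr by (simp add: K_def minus_eq_smult part_smult ideal_smult[OF idl])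
      show "x \<oplus> y \<in> K" if "x \<in> K" "y \<in> K" for x y
        using that I.Icarr by (simp add: K_def part_add)
    qed
    show "x \<otimes> a \<in> K" "a \<otimes> x \<in> K" if "a \<in> K" "x \<in> carrier A" for a x
    proof -
      have a: "a \<in> Idl S" "a \<in> carrier A" "\<And>d. part d a \<in> Idl S"
        using that(1) I.Icarr by (simp_all add: K_def)
      have "part d (x \<otimes> a) \<in> Idl S" "part d (a \<otimes> x) \<in> Idl S" for d
        unfolding part_mult[OF that(2) a(2)] part_mult[OF a(2) that(2)]
        by (intro I.a_closed I.I_l_closed I.I_r_closed a part_closed that(2))+
      then show "x \<otimes> a \<in> K" "a \<otimes> x \<in> K"
        using a that(2) by (simp_all add: K_def I.I_l_closed I.I_r_closed)
    qed
  qed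
  moreover have "S \<subseteq> K"
  proof
    fix x assume x: "x \<in> S"
    then obtain e where "x \<in> homog A e" using S by blast
    moreover have "x \<in> Idl S" using genideal_self \<open>S \<subseteq> carrier A\<close> x by blast
    ultimately show "x \<in> K" by (simp add: K_def part_of_homog)
  qed
  ultimately have "Idl S \<subseteq> K" by (rule genideal_minimal)
  then show ?thesis using idl by (auto simp: graded_ideal_def K_def)
qed

section \<open>Quotients by graded ideals\<close>

context
  fixes I assumes graded: "graded_ideal I"
begin

interpretation I: ideal I A using graded by (simp add: graded_ideal_def)

abbreviation (input) "Q \<equiv> quotient_superalgebra A I"

lemma part_ideal: "x \<in> I \<Longrightarrow> part d x \<in> I"
  using graded by (simp add: graded_ideal_def)

lemma coset_eq_iff:
  assumes "x \<in> carrier A" "y \<in> carrier A"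
  shows "I +> x = I +> y \<longleftrightarrow> x \<ominus> y \<in> I"
  using assms
  by (metis I.a_rcos_module_minus I.a_rcos_self I.a_repr_independence' ring_axioms)

lemma quotient_carrier: "carrier Q = (+>) I ` carrier A"
  by (auto simp: quotient_superalgebra_def FactRing_simps)

lemma quotient_simps:
  "zero Q = I" "one Q = I +> \<one>" "homog Q d = (+>) I ` homog A d"
  by (simp_all add: quotient_superalgebra_def FactRing_def)

lemma quotient_ops:
  assumes "x \<in> carrier A" "y \<in> carrier A"
  shows "(I +> x) \<oplus>\<^bsub>Q\<^esub> (I +> y) = I +> (x \<oplus> y)"
    and "(I +> x) \<otimes>\<^bsub>Q\<^esub> (I +> y) = I +> (x \<otimes> y)"
  using assms by (simp_all add: quotient_superalgebra_def FactRing_def I.a_rcos_sum I.rcoset_mult_add)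

lemma quotient_smult:
  assumes x: "x \<in> carrier A"
  shows "c \<odot>\<^bsub>Q\<^esub> (I +> x) = I +> (c \<odot> x)"
proof -
  have "I +> (c \<odot> x') = I +> (c \<odot> x)" if x': "x' \<in> I +> x" for x'
  proof -
    have car: "x' \<in> carrier A" using I.a_elemrcos_carrier x x' by blast
    have "x' \<ominus> x \<in> I" using I.a_rcos_module_minus[OF ring_axioms x car] x' by simp
    moreover have "c \<odot> x' \<ominus> c \<odot> x = c \<odot> (x' \<ominus> x)"
      using x car
      by (simp add: a_minus_def minus_eq_smult smult_add_right smult_smult mult.commute)
    ultimately show ?thesis
      using x car ideal_smult[OF I.ideal_axioms, of "x' \<ominus> x" c] by (simp add: coset_eq_iff)
  qed
  moreover have "x \<in> I +> x" using x by (rule I.a_rcos_self)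
  ultimately have "(\<Union>x'\<in>I +> x. I +> (c \<odot> x')) = I +> (c \<odot> x)" by blast
  then show ?thesis by (simp add: quotient_superalgebra_def)
qed

text \<open>Gradedness of the ideal is why the two components of the quotient meet only in zero: if an even
  \<open>x\<close> and an odd \<open>y\<close> are congruent, then \<open>x\<close> is the even part of \<open>x - y\<close> and hence lies in the ideal.\<close>

lemma superalgebra_quotient: "superalgebra Q"
proof (rule superalgebraI)
  interpret R: ring "A Quot I" by (rule I.quotient_is_ring)
  have eq: "carrier Q = carrier (A Quot I)" "monoid.mult Q = monoid.mult (A Quot I)"
    "one Q = one (A Quot I)" "zero Q = zero (A Quot I)" "add Q = add (A Quot I)"
    by (simp_all add: quotient_superalgebra_def)
  show "ring Q"
  proof (rule ringI)
    show "abelian_group Q"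
      by (rule abelian_groupI) (auto simp: eq R.a_ac intro: R.l_neg R.a_inv_closed)
    show "monoid Q"
      by (rule monoidI) (simp_all add: eq R.m_assoc)
  qed (simp_all add: eq R.l_distr R.r_distr)
  show "C = \<zero>\<^bsub>Q\<^esub>" if "C \<in> homog Q 0" "C \<in> homog Q 1" for C
  proof -
    from that obtain x y where xy: "x \<in> homog A 0" "y \<in> homog A 1" "C = I +> x" "C = I +> y"
      by (auto simp: quotient_simps)
    then have car: "x \<in> carrier A" "y \<in> carrier A" by (auto simp: homog_carrier)
    have "x \<oplus> (\<ominus> y) \<in> I" using xy car coset_eq_iff[of x y] by (simp add: a_minus_def)
    moreover have "part 0 (x \<oplus> (\<ominus> y)) = x"
      using xy by (intro part_eqI) (simp_all add: homog_minus)
    ultimately have "x \<in> I" using part_ideal by metis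
    then show ?thesis using xy by (simp add: quotient_simps I.a_rcos_const)
  qed
  show "\<exists>D\<in>homog Q 0. \<exists>E\<in>homog Q 1. C = D \<oplus>\<^bsub>Q\<^esub> E" if "C \<in> carrier Q" for C
  proof -
    from that obtain x where x: "x \<in> carrier A" "C = I +> x" by (auto simp: quotient_carrier)
    then have "C = (I +> part 0 x) \<oplus>\<^bsub>Q\<^esub> (I +> part 1 x)"
      using part_sum[of x 0] by (simp add: quotient_ops)
    then show ?thesis using part_homog[OF x(1)] by (auto simp: quotient_simps)
  qed
  show "\<zero>\<^bsub>Q\<^esub> \<in> homog Q d" for d
    using I.a_rcos_const[OF I.zero_closed] homog_zero[of d] by (force simp: quotient_simps)
  show "C \<otimes>\<^bsub>Q\<^esub> D \<in> homog Q (d + e)" if CD: "C \<in> homog Q d" "D \<in> homog Q e" for C D d e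
  proof -
    from CD obtain x y where "x \<in> homog A d" "y \<in> homog A e" "C = I +> x" "D = I +> y"
      unfolding quotient_simps by blast
    then show ?thesis
      using homog_mult[of x d y e] homog_carrier by (simp only: quotient_ops quotient_simps imageI)
  qed
qed (auto simp: quotient_carrier quotient_simps quotient_ops quotient_smult smult_add_left
    smult_add_right smult_smult smult_mult_left smult_mult_right homog_carrier homog_add
    homog_smult homog_one intro!: imageI)

lemma part_quotient:
  assumes "x \<in> carrier A"
  shows "homog_part Q d (I +> x) = I +> part d x"
proof (rule superalgebra.part_eqI[OF superalgebra_quotient])
  show "I +> x = (I +> part d x) \<oplus>\<^bsub>Q\<^esub> (I +> part (d + 1) x)"
    using assms part_sum[of x d] by (simp only: quotient_ops part_closed)
qed (use assms in \<open>simp_all only: quotient_simps imageI part_homog\<close>)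

text \<open>Taking homogeneous parts commutes with passing to cosets, so twisting commutes with forming
  the quotient.\<close>

lemma twist_quotient_mult:
  assumes "x \<in> carrier A" "y \<in> carrier A"
  shows "(I +> x) \<otimes>\<^bsub>twist \<zeta> Q\<^esub> (I +> y) = I +> (x \<otimes>\<^bsub>twist \<zeta> A\<^esub> y)"
  using assms
  by (simp add: superalgebra.twist_mult_eq[OF superalgebra_quotient] quotient_carrier part_quotient
      twist_mult_eq quotient_ops quotient_smult)

end

end

section \<open>Isomorphisms onto a twist\<close>

text \<open>The factor \<open>\<zeta> d e\<close> in the last hypothesis is the one that the twisted product of \<open>B\<close> puts
  on homogeneous elements; biadditivity of both products extends multiplicativity to all elements.\<close>

lemma superalgebra_iso_twistI:
  fixes A :: "('k::field, 'a, 'm) superalgebra_scheme"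
    and B :: "('k, 'b, 'n) superalgebra_scheme"
  assumes A: "superalgebra A" and B: "superalgebra B" and \<zeta>: "normalized_2cocycle \<zeta>"
    and bij: "bij_betw f (carrier A) (carrier B)"
    and one: "f \<one>\<^bsub>A\<^esub> = \<one>\<^bsub>B\<^esub>"
    and add: "\<And>x y. \<lbrakk>x \<in> carrier A; y \<in> carrier A\<rbrakk> \<Longrightarrow> f (x \<oplus>\<^bsub>A\<^esub> y) = f x \<oplus>\<^bsub>B\<^esub> f y"
    and smult: "\<And>c x. x \<in> carrier A \<Longrightarrow> f (c \<odot>\<^bsub>A\<^esub> x) = c \<odot>\<^bsub>B\<^esub> f x"
    and homog: "\<And>d x. x \<in> homog A d \<Longrightarrow> f x \<in> homog B d"
    and mult: "\<And>d e x y. \<lbrakk>x \<in> homog A d; y \<in> homog A e\<rbrakk>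
      \<Longrightarrow> f (x \<otimes>\<^bsub>A\<^esub> y) = \<zeta> d e \<odot>\<^bsub>B\<^esub> (f x \<otimes>\<^bsub>B\<^esub> f y)"
  shows "superalgebra_iso A (twist \<zeta> B) f"
proof -
  interpret A: superalgebra A by (rule A)
  interpret B: superalgebra B by (rule B)
  have car: "f x \<in> carrier B" if "x \<in> carrier A" for x
    using bij that by (auto simp: bij_betw_def)
  have "f (x \<otimes>\<^bsub>A\<^esub> y) = f x \<otimes>\<^bsub>twist \<zeta> B\<^esub> f y" if x: "x \<in> carrier A" and y: "y \<in> carrier A" for x y
    using x
  proof (induction x rule: A.homog_induct)
    case (homog d x)
    note x = this
    show ?case
      using y
    proof (induction y rule: A.homog_induct)
      case (homog e y)
      then show ?case using x by (simp add: mult B.twist_mult_homog[of _ d _ e] assms(8))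
    qed (use A.homog_carrier[OF x] in \<open>simp add: A.r_distr add B.twist_distrib car\<close>)
  qed (use y in \<open>simp add: A.l_distr add B.twist_distrib car\<close>)
  then have "f \<in> ring_iso A (twist \<zeta> B)"
    using bij one add car by (auto simp: ring_iso_def ring_hom_def)
  then show ?thesis
    using A B.superalgebra_twist[OF \<zeta>] smult homog by (auto simp: superalgebra_iso_def)
qed

lemma superalgebra_iso_part:
  assumes iso: "superalgebra_iso A B f" and x: "x \<in> carrier A"
  shows "f (homog_part A d x) = homog_part B d (f x)"
proof -
  interpret A: superalgebra A using iso by (simp add: superalgebra_iso_def)
  interpret B: superalgebra B using iso by (simp add: superalgebra_iso_def)
  have "f x = f (A.part d x \<oplus>\<^bsub>A\<^esub> A.part (d + 1) x)" by (simp only: A.part_sum[OF x])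
  also have "\<dots> = f (A.part d x) \<oplus>\<^bsub>B\<^esub> f (A.part (d + 1) x)"
    using iso A.part_closed[OF x] by (simp only: superalgebra_iso_def ring_iso_def ring_hom_def) blast
  finally have "B.part d (f x) = f (A.part d x)"
    using iso A.part_homog[OF x]
    by (intro B.part_eqI[of _ _ "f (A.part (d + 1) x)"]) (auto simp only: superalgebra_iso_def image_subset_iff)
  then show ?thesis by simp
qed

lemma graded_ideal_image:
  assumes iso: "superalgebra_iso A B f" and I: "superalgebra.graded_ideal A I"
  shows "superalgebra.graded_ideal B (f ` I)"
proof -
  interpret A: superalgebra A using iso by (simp add: superalgebra_iso_def)
  interpret B: superalgebra B using iso by (simp add: superalgebra_iso_def)
  interpret I: ideal I A using I by (simp add: A.graded_ideal_def)
  have hom: "f \<in> ring_hom A B" and bij: "bij_betw f (carrier A) (carrier B)"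
    using iso by (auto simp: superalgebra_iso_def ring_iso_def image_subset_iff)
  interpret h: ring_hom_ring A B f
    using hom by (intro ring_hom_ringI2) (rule A.ring_axioms B.ring_axioms)+
  have "ideal (f ` I) B"
  proof (rule idealI)
    show "ring B" by (rule B.ring_axioms)
    show "subgroup (f ` I) (add_monoid B)" by (rule h.img_is_add_subgroup[OF I.a_subgroup])
    show "y \<otimes>\<^bsub>B\<^esub> b \<in> f ` I" "b \<otimes>\<^bsub>B\<^esub> y \<in> f ` I" if b: "b \<in> f ` I" and y: "y \<in> carrier B" for b y
    proof -
      obtain a where a: "a \<in> I" "b = f a" using b by blast
      obtain x where x: "x \<in> carrier A" "y = f x"
        using y bij by (auto simp: bij_betw_def)
      from a x have "y \<otimes>\<^bsub>B\<^esub> b = f (x \<otimes>\<^bsub>A\<^esub> a)" "b \<otimes>\<^bsub>B\<^esub> y = f (a \<otimes>\<^bsub>A\<^esub> x)"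
        using I.Icarr[OF a(1)] by simp_all
      then show "y \<otimes>\<^bsub>B\<^esub> b \<in> f ` I" "b \<otimes>\<^bsub>B\<^esub> y \<in> f ` I"
        using I.I_l_closed[OF a(1) x(1)] I.I_r_closed[OF a(1) x(1)] by simp_all
    qed
  qed
  then show ?thesis
    using I superalgebra_iso_part[OF iso, symmetric] I.Icarr
    by (auto simp: B.graded_ideal_def A.graded_ideal_def)
qed

text \<open>The map of quotients is written as the direct image of cosets: since \<open>f\<close> is a bijection, this
  is again a bijection of cosets, and it needs no choice of representatives. The second claim
  describes it on classes.\<close>

lemma superalgebra_iso_quotient:
  assumes iso: "superalgebra_iso A (twist \<zeta> B) f" and B: "superalgebra B"
    and \<zeta>: "normalized_2cocycle \<zeta>" and I: "superalgebra.graded_ideal A I"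
  shows "superalgebra_iso (quotient_superalgebra A I)
    (twist \<zeta> (quotient_superalgebra B (f ` I))) ((`) f)"
    and "\<And>x. x \<in> carrier A \<Longrightarrow> f ` (I +>\<^bsub>A\<^esub> x) = f ` I +>\<^bsub>B\<^esub> f x"
proof -
  interpret A: superalgebra A using iso by (simp add: superalgebra_iso_def)
  interpret B: superalgebra B by (rule B)
  interpret tB: superalgebra "twist \<zeta> B" by (rule B.superalgebra_twist[OF \<zeta>])
  interpret I: ideal I A using I by (simp add: A.graded_ideal_def)
  have J: "B.graded_ideal (f ` I)"
    using graded_ideal_image[OF iso I] B.graded_ideal_twist_iff[OF \<zeta>] by simp
  let ?A = "quotient_superalgebra A I" and ?B = "quotient_superalgebra B (f ` I)"
  interpret QA: superalgebra ?A by (rule A.superalgebra_quotient[OF I])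
  interpret QB: superalgebra ?B by (rule B.superalgebra_quotient[OF J])
  have hom: "f \<in> ring_hom A (twist \<zeta> B)" and bij: "bij_betw f (carrier A) (carrier B)"
    and smult: "\<And>c x. x \<in> carrier A \<Longrightarrow> f (c \<odot>\<^bsub>A\<^esub> x) = c \<odot>\<^bsub>B\<^esub> f x"
    and homog: "\<And>d x. x \<in> homog A d \<Longrightarrow> f x \<in> homog B d"
    using iso by (auto simp: superalgebra_iso_def ring_iso_def image_subset_iff)
  have car: "f x \<in> carrier B" if "x \<in> carrier A" for x
    using bij that by (auto simp: bij_betw_def)
  show coset: "f ` (I +>\<^bsub>A\<^esub> x) = f ` I +>\<^bsub>B\<^esub> f x" if "x \<in> carrier A" for x
    using a_coset_hom(2)[OF hom I.a_subset that] by (simp add: a_r_coset_def)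
  have "bij_betw ((`) f) (carrier ?A) (carrier ?B)"
  proof (rule bij_betw_imageI)
    have sub: "\<Union> (carrier ?A) \<subseteq> carrier A"
      unfolding A.quotient_carrier[OF I] by (intro UN_least subsetI) (erule (1) I.a_elemrcos_carrier)
    show "inj_on ((`) f) (carrier ?A)"
      by (rule inj_on_image[OF inj_on_subset[OF bij_betw_imp_inj_on[OF bij] sub]])
    have "(`) f ` carrier ?A = (\<lambda>x. f ` I +>\<^bsub>B\<^esub> f x) ` carrier A"
      unfolding A.quotient_carrier[OF I] image_image using coset by (intro image_cong) auto
    also have "\<dots> = carrier ?B"
      by (simp only: B.quotient_carrier[OF J] image_image flip: bij_betw_imp_surj_on[OF bij])
    finally show "(`) f ` carrier ?A = carrier ?B" .
  qed
  moreover have "(`) f \<in> ring_hom ?A (twist \<zeta> ?B)"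
  proof (rule ring_hom_memI)
    show "f ` C \<in> carrier (twist \<zeta> ?B)" if "C \<in> carrier ?A" for C
      using that unfolding A.quotient_carrier[OF I] QB.twist_simps B.quotient_carrier[OF J]
      by (elim imageE) (simp add: coset car)
    show "f ` \<one>\<^bsub>?A\<^esub> = \<one>\<^bsub>twist \<zeta> ?B\<^esub>"
      using ring_hom_one[OF hom]
      by (simp add: A.quotient_simps[OF I] B.quotient_simps[OF J] coset)
    fix C D assume "C \<in> carrier ?A" "D \<in> carrier ?A"
    then obtain x y where xy: "x \<in> carrier A" "y \<in> carrier A" "C = I +>\<^bsub>A\<^esub> x" "D = I +>\<^bsub>A\<^esub> y"
      by (auto simp: A.quotient_carrier[OF I])
    then show "f ` (C \<otimes>\<^bsub>?A\<^esub> D) = f ` C \<otimes>\<^bsub>twist \<zeta> ?B\<^esub> f ` D"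
      using ring_hom_mult[OF hom, of x y]
      by (simp add: A.quotient_ops[OF I] B.twist_quotient_mult[OF J] coset car)
    from xy show "f ` (C \<oplus>\<^bsub>?A\<^esub> D) = f ` C \<oplus>\<^bsub>twist \<zeta> ?B\<^esub> f ` D"
      using ring_hom_add[OF hom, of x y]
      by (simp add: A.quotient_ops[OF I] B.quotient_ops[OF J] coset car)
  qed
  ultimately have "(`) f \<in> ring_iso ?A (twist \<zeta> ?B)" by (simp add: ring_iso_def)
  moreover have "f ` (c \<odot>\<^bsub>?A\<^esub> C) = c \<odot>\<^bsub>twist \<zeta> ?B\<^esub> f ` C" if "C \<in> carrier ?A" for c C
    using that unfolding A.quotient_carrier[OF I]
    by (elim imageE) (simp add: A.quotient_smult[OF I] B.quotient_smult[OF J] coset car smult)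
  moreover have "f ` C \<in> homog (twist \<zeta> ?B) d" if C: "C \<in> homog ?A d" for C d
  proof -
    from C obtain x where "x \<in> homog A d" "C = I +>\<^bsub>A\<^esub> x"
      unfolding A.quotient_simps[OF I] by blast
    then show ?thesis by (simp add: B.quotient_simps[OF J] coset homog A.homog_carrier)
  qed
  ultimately show "superalgebra_iso ?A (twist \<zeta> ?B) ((`) f)"
    using QA.superalgebra_axioms QB.superalgebra_twist[OF \<zeta>]
    by (simp add: superalgebra_iso_def image_subset_iff)
qed

text \<open>The generated ideals are taken in \<open>A\<close> and in the untwisted \<open>B\<close>, while \<open>f\<close> is multiplicative
  for the twisted product of \<open>B\<close>. The preimage of the right-hand side is an ideal because graded
  ideals of \<open>B\<close> are ideals of the twist, and the image of the left-hand side is an ideal of \<open>B\<close> by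
  the converse.\<close>

lemma image_genideal_twist:
  assumes iso: "superalgebra_iso A (twist \<zeta> B) f" and B: "superalgebra B"
    and \<zeta>: "normalized_2cocycle \<zeta>" and S: "S \<subseteq> (\<Union>d. homog A d)"
  shows "f ` genideal A S = genideal B (f ` S)"
proof -
  interpret A: superalgebra A using iso by (simp add: superalgebra_iso_def)
  interpret B: superalgebra B by (rule B)
  have hom: "f \<in> ring_hom A (twist \<zeta> B)" and homog: "\<And>d x. x \<in> homog A d \<Longrightarrow> f x \<in> homog B d"
    using iso by (auto simp: superalgebra_iso_def ring_iso_def image_subset_iff)
  have ScA: "S \<subseteq> carrier A" using S by (auto dest: A.homog_carrier)
  have fS: "f ` S \<subseteq> (\<Union>d. homog B d)"
  proof
    fix y assume "y \<in> f ` S"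
    then obtain x d where "y = f x" "x \<in> homog A d" using S by blast
    then show "y \<in> (\<Union>d. homog B d)" using homog by (intro UN_I[of d]) simp_all
  qed
  then have ScB: "f ` S \<subseteq> carrier B" by (auto dest: B.homog_carrier)
  have grA: "A.graded_ideal (genideal A S)" by (rule A.graded_ideal_genideal[OF S])
  have grB: "B.graded_ideal (genideal B (f ` S))" by (rule B.graded_ideal_genideal[OF fS])
  interpret tB: superalgebra "twist \<zeta> B" by (rule B.superalgebra_twist[OF \<zeta>])
  interpret h: ring_hom_ring A "twist \<zeta> B" f
    using hom by (intro ring_hom_ringI2) (rule A.ring_axioms tB.ring_axioms)+
  show ?thesis
  proof
    have "ideal {x \<in> carrier A. f x \<in> genideal B (f ` S)} A"
      using grB B.graded_ideal_twist_iff[OF \<zeta>, of "genideal B (f ` S)"]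
      by (intro h.ideal_vimage) (simp add: tB.graded_ideal_def)
    moreover have "S \<subseteq> {x \<in> carrier A. f x \<in> genideal B (f ` S)}"
      using ScA B.genideal_self[OF ScB] by blast
    ultimately have "genideal A S \<subseteq> {x \<in> carrier A. f x \<in> genideal B (f ` S)}"
      by (rule A.genideal_minimal)
    then show "f ` genideal A S \<subseteq> genideal B (f ` S)" by blast
    have "B.graded_ideal (f ` genideal A S)"
      using graded_ideal_image[OF iso grA] B.graded_ideal_twist_iff[OF \<zeta>] by simp
    then show "genideal B (f ` S) \<subseteq> f ` genideal A S"
      using A.genideal_self[OF ScA] by (intro B.genideal_minimal) (auto simp: B.graded_ideal_def)
  qed
qed

section \<open>Algebras on a basis\<close>

lemma lookup_scale [simp]: "Poly_Mapping.lookup (scale c x) k = c * Poly_Mapping.lookup x k"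
  by (simp add: scale_def Poly_Mapping.map.rep_eq when_def)

lemma scale_single [simp]: "scale c (Poly_Mapping.single k d) = Poly_Mapping.single k (c * d)"
  by (rule poly_mapping_eqI) (simp add: lookup_single when_def)

lemma scale_scale [simp]: "scale c (scale d x) = scale (c * d) x"
  by (rule poly_mapping_eqI) (simp add: mult.assoc)

lemma scale_zero [simp]: "scale c 0 = 0" "scale 0 x = 0"
  by (rule poly_mapping_eqI; simp)+

lemma scale_one [simp]: "scale 1 x = x"
  by (rule poly_mapping_eqI) simp

lemma scale_add_left: "scale (c + d) x = scale c x + scale d x"
  by (rule poly_mapping_eqI) (simp add: lookup_add distrib_right)

lemma scale_add_right: "scale c (x + y) = scale c x + scale c y"
  by (rule poly_mapping_eqI) (simp add: lookup_add distrib_left)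

lemma scale_sum: "scale c (\<Sum>i\<in>I. f i) = (\<Sum>i\<in>I. scale c (f i))"
  by (rule poly_mapping_eqI) (simp add: lookup_sum sum_distrib_left)

lemma keys_scale_subset: "Poly_Mapping.keys (scale c x) \<subseteq> Poly_Mapping.keys x"
  by (auto simp: in_keys_iff)

lemma lookup_pure_tensor [simp]:
  "Poly_Mapping.lookup (x \<otimes>\<^sub>p y) (a, b) = Poly_Mapping.lookup x a * Poly_Mapping.lookup y b"
proof -
  have "Poly_Mapping.lookup (x \<otimes>\<^sub>p y) (a, b) =
    (\<Sum>a'\<in>Poly_Mapping.keys x. \<Sum>b'\<in>Poly_Mapping.keys y.
      if b' = b then (if a' = a then Poly_Mapping.lookup x a * Poly_Mapping.lookup y b else 0) else 0)"
    by (auto simp: pure_tensor_def lookup_sum lookup_single when_def intro!: sum.cong)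
  also have "\<dots> = Poly_Mapping.lookup x a * Poly_Mapping.lookup y b"
    by (cases "Poly_Mapping.lookup y b = 0") (simp_all add: sum.delta in_keys_iff)
  finally show ?thesis .
qed

lemma keys_pure_tensor_subset:
  "Poly_Mapping.keys (x \<otimes>\<^sub>p y) \<subseteq> Poly_Mapping.keys x \<times> Poly_Mapping.keys y"
  by (auto simp: in_keys_iff)

lemma lookup_coefficient [simp]:
  "Poly_Mapping.lookup (coefficient Y e) a = Poly_Mapping.lookup Y (a, e)"
proof -
  have "Poly_Mapping.lookup (coefficient Y e) a =
    (\<Sum>p\<in>{p \<in> Poly_Mapping.keys Y. snd p = e}. if p = (a, e) then Poly_Mapping.lookup Y (a, e) else 0)"
    unfolding coefficient_def lookup_sum
    by (intro sum.cong) (auto simp: lookup_single when_def split: if_splits)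
  also have "\<dots> = Poly_Mapping.lookup Y (a, e)"
    by (simp add: sum.delta in_keys_iff)
  finally show ?thesis .
qed

lemma keys_subset_sum:
  "(\<And>i. i \<in> I \<Longrightarrow> Poly_Mapping.keys (f i) \<subseteq> S) \<Longrightarrow> Poly_Mapping.keys (\<Sum>i\<in>I. f i) \<subseteq> S"
  using keys_sum[of f I] by blast

lemma keys_subset_scale: "Poly_Mapping.keys x \<subseteq> S \<Longrightarrow> Poly_Mapping.keys (scale c x) \<subseteq> S"
  using keys_scale_subset by fast

lemma keys_subset_diff:
  fixes x y :: "'a \<Rightarrow>\<^sub>0 ratfun"
  shows "\<lbrakk>Poly_Mapping.keys x \<subseteq> S; Poly_Mapping.keys y \<subseteq> S\<rbrakk> \<Longrightarrow> Poly_Mapping.keys (x - y) \<subseteq> S"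
  using keys_diff[of x y] by fast

lemma poly_mapping_single_induct [case_names zero add]:
  assumes "P 0" and "\<And>x k c. P x \<Longrightarrow> P (x + Poly_Mapping.single k c)"
  shows "P (x :: 'b \<Rightarrow>\<^sub>0 ratfun)"
proof (induction x rule: update_induct)
  case (update f k c)
  have "Poly_Mapping.update k c f = f + Poly_Mapping.single k c"
    using update(1)
    by (intro poly_mapping_eqI) (auto simp: lookup_update lookup_add lookup_single in_keys_iff)
  then show ?case using assms(2) update by simp
qed (rule assms(1))

text \<open>The sums over the supports may be extended to any larger finite sets; with common index sets
  for several elements, bilinearity becomes a termwise statement.\<close>

lemma alg_mult_superset:
  assumes "finite K" "Poly_Mapping.keys x \<subseteq> K" "finite L" "Poly_Mapping.keys y \<subseteq> L"
  shows "alg_mult A x y = (\<Sum>a\<in>K. \<Sum>b\<in>L.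
    scale (Poly_Mapping.lookup x a * Poly_Mapping.lookup y b) (bprod A a b))"
proof -
  have "alg_mult A x y = (\<Sum>a\<in>Poly_Mapping.keys x. \<Sum>b\<in>L.
      scale (Poly_Mapping.lookup x a * Poly_Mapping.lookup y b) (bprod A a b))"
    unfolding alg_mult_def using assms
    by (intro sum.cong refl sum.mono_neutral_left) (auto simp: in_keys_iff)
  also have "\<dots> = (\<Sum>a\<in>K. \<Sum>b\<in>L.
      scale (Poly_Mapping.lookup x a * Poly_Mapping.lookup y b) (bprod A a b))"
    using assms by (intro sum.mono_neutral_left) (auto simp: in_keys_iff)
  finally show ?thesis .
qed

lemma alg_mult_add:
  shows alg_mult_add_left: "alg_mult A (x + y) z = alg_mult A x z + alg_mult A y z"
    and alg_mult_add_right: "alg_mult A z (x + y) = alg_mult A z x + alg_mult A z y"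
proof -
  let ?K = "Poly_Mapping.keys x \<union> Poly_Mapping.keys y" and ?L = "Poly_Mapping.keys z"
  have K: "finite ?K" "finite ?L" "Poly_Mapping.keys x \<subseteq> ?K" "Poly_Mapping.keys y \<subseteq> ?K"
    "Poly_Mapping.keys (x + y) \<subseteq> ?K" using keys_add[of x y] by auto
  show "alg_mult A (x + y) z = alg_mult A x z + alg_mult A y z"
    using K by (simp add: alg_mult_superset[of ?K _ ?L] lookup_add distrib_right scale_add_left
        sum.distrib del: finite_Un)
  show "alg_mult A z (x + y) = alg_mult A z x + alg_mult A z y"
    using K by (simp add: alg_mult_superset[of ?L _ ?K] lookup_add distrib_left scale_add_left
        sum.distrib del: finite_Un)
qed

lemma alg_mult_scale:
  shows alg_mult_scale_left: "alg_mult A (scale c x) y = scale c (alg_mult A x y)"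
    and alg_mult_scale_right: "alg_mult A x (scale c y) = scale c (alg_mult A x y)"
  by (simp_all add: alg_mult_superset[of "Poly_Mapping.keys x" _ "Poly_Mapping.keys y"]
      keys_scale_subset scale_sum mult.assoc mult.left_commute)

lemma alg_mult_zero [simp]: "alg_mult A 0 x = 0" "alg_mult A x 0 = 0"
  by (simp_all add: alg_mult_def)

lemma alg_mult_single:
  "alg_mult A (Poly_Mapping.single a c) (Poly_Mapping.single b d) = scale (c * d) (bprod A a b)"
  by (simp add: alg_mult_superset[of "{a}" _ "{b}"])

lemma keys_alg_mult_subset:
  assumes "\<And>a b. \<lbrakk>a \<in> Poly_Mapping.keys x; b \<in> Poly_Mapping.keys y\<rbrakk>
    \<Longrightarrow> Poly_Mapping.keys (bprod A a b) \<subseteq> S"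
  shows "Poly_Mapping.keys (alg_mult A x y) \<subseteq> S"
  unfolding alg_mult_def by (intro keys_subset_sum keys_subset_scale assms)

definition rescale :: "('b \<Rightarrow> ratfun) \<Rightarrow> ('b \<Rightarrow>\<^sub>0 ratfun) \<Rightarrow> ('b \<Rightarrow>\<^sub>0 ratfun)" where
  "rescale s = Poly_Mapping.mapp (\<lambda>k c. s k * c)"

lemma lookup_rescale [simp]:
  "Poly_Mapping.lookup (rescale s x) k = s k * Poly_Mapping.lookup x k"
  by (simp add: rescale_def lookup_mapp when_def in_keys_iff)

lemma keys_rescale: "(\<And>k. s k \<noteq> 0) \<Longrightarrow> Poly_Mapping.keys (rescale s x) = Poly_Mapping.keys x"
  by (auto simp: in_keys_iff)

lemma rescale_linear:
  "rescale s (x + y) = rescale s x + rescale s y"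
  "rescale s (x - y) = rescale s x - rescale s y"
  "rescale s (scale c x) = scale c (rescale s x)"
  "rescale s (\<Sum>i\<in>I. f i) = (\<Sum>i\<in>I. rescale s (f i))"
  by (rule poly_mapping_eqI;
      simp add: lookup_add lookup_minus lookup_sum sum_distrib_left algebra_simps)+

lemma rescale_single [simp]:
  "rescale s (Poly_Mapping.single k c) = Poly_Mapping.single k (s k * c)"
  by (rule poly_mapping_eqI) (simp add: lookup_single when_def)

lemma rescale_eq_scale:
  "(\<And>k. k \<in> Poly_Mapping.keys x \<Longrightarrow> s k = c) \<Longrightarrow> rescale s x = scale c x"
  by (rule poly_mapping_eqI) (auto simp: in_keys_iff)

lemma coefficient_rescale:
  "coefficient (rescale (\<lambda>(a, b). s a) Y) e = rescale s (coefficient Y e)"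
  by (rule poly_mapping_eqI) simp

section \<open>The free superalgebra and its reordering signs\<close>

lemma bit_add_self [simp]: "x + x = (0 :: bit)"
  by (cases x) simp_all

lemma zeta_add_left: "zeta (a + b) c = zeta a c * zeta b c"
  and zeta_add_right: "zeta a (b + c) = zeta a b * zeta a c"
  by (cases a; cases b; cases c; simp add: zeta_def parity_sign_def)+

lemma zeta_square [simp]: "zeta a b * zeta a b = 1"
  by (simp add: zeta_def parity_sign_def)

lemma zeta_zero [simp]: "zeta 0 b = 1" "zeta a 0 = 1"
  by (simp_all add: zeta_def parity_sign_def)

abbreviation word_parity :: "(nat \<Rightarrow> bit) \<Rightarrow> gen list \<Rightarrow> bit" where
  "word_parity par w \<equiv> sum_list (map (gen_parity par) w)"

text \<open>This is \<open>-1\<close> to the number of pairs of odd letters. It is the scalar between a word and the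
  product of its letters in the twist of the free superalgebra.\<close>

primrec word_sign :: "(nat \<Rightarrow> bit) \<Rightarrow> gen list \<Rightarrow> ratfun" where
  "word_sign par [] = 1"
| "word_sign par (g # w) = zeta (gen_parity par g) (word_parity par w) * word_sign par w"

text \<open>The pairs of odd letters of \<open>v @ w\<close> are those inside \<open>v\<close>, those inside \<open>w\<close>, and one for each
  choice of an odd letter in \<open>v\<close> and one in \<open>w\<close>; the number of the latter is odd exactly if both
  parities are odd.\<close>

lemma word_sign_append:
  "word_sign par (v @ w) =
    zeta (word_parity par v) (word_parity par w) * (word_sign par v * word_sign par w)"
proof (induction v)
  case (Cons g v)
  have "word_sign par ((g # v) @ w) =
    zeta (gen_parity par g) (word_parity par v + word_parity par w) * word_sign par (v @ w)"
    by (simp only: append_Cons word_sign.simps map_append sum_list_append)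
  then show ?case
    by (simp only: Cons word_sign.simps list.map sum_list_simps zeta_add_left zeta_add_right mult_ac)
qed simp

lemma word_sign_square [simp]: "word_sign par w * word_sign par w = 1"
proof (induction w)
  case (Cons g w)
  have "word_sign par (g # w) * word_sign par (g # w) =
    (zeta (gen_parity par g) (word_parity par w) * zeta (gen_parity par g) (word_parity par w))
    * (word_sign par w * word_sign par w)"
    by (simp only: word_sign.simps mult_ac)
  then show ?case using Cons by simp
qed simp

lemma word_sign_nonzero [simp]: "word_sign par w \<noteq> 0"
  using word_sign_square[of par w] by fastforce

abbreviation free_superalgebra ::
    "nat \<Rightarrow> (nat \<Rightarrow> bit) \<Rightarrow> (ratfun, gen list \<Rightarrow>\<^sub>0 ratfun) superalgebra" where
  "free_superalgebra N par \<equiv> superalgebra_of (free_algebra N par)"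

lemma free_algebra_simps [simp]:
  "basis (free_algebra N par) = lists (gens N)"
  "bdeg (free_algebra N par) w = word_parity par w"
  "bprod (free_algebra N par) v w = Poly_Mapping.single (v @ w) 1"
  "bunit (free_algebra N par) = Poly_Mapping.single [] 1"
  by (simp_all add: free_algebra_def)

lemma free_superalgebra_simps [simp]:
  "carrier (free_superalgebra N par) = {x. Poly_Mapping.keys x \<subseteq> lists (gens N)}"
  "monoid.mult (free_superalgebra N par) = alg_mult (free_algebra N par)"
  "one (free_superalgebra N par) = Poly_Mapping.single [] 1"
  "zero (free_superalgebra N par) = 0"
  "add (free_superalgebra N par) = (+)"
  "smult (free_superalgebra N par) = scale"
  "homog (free_superalgebra N par) d =
    {x. Poly_Mapping.keys x \<subseteq> {w \<in> lists (gens N). word_parity par w = d}}"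
  by (simp_all add: superalgebra_of_def)

lemma free_mult_assoc:
  "alg_mult (free_algebra N par) (alg_mult (free_algebra N par) x y) z =
    alg_mult (free_algebra N par) x (alg_mult (free_algebra N par) y z)"
proof (induction x rule: poly_mapping_single_induct)
  case (add x u a)
  have "alg_mult (free_algebra N par) (alg_mult (free_algebra N par) (Poly_Mapping.single u a) y) z =
    alg_mult (free_algebra N par) (Poly_Mapping.single u a) (alg_mult (free_algebra N par) y z)"
  proof (induction y rule: poly_mapping_single_induct)
    case (add y v b)
    have "alg_mult (free_algebra N par)
        (alg_mult (free_algebra N par) (Poly_Mapping.single u a) (Poly_Mapping.single v b)) z =
      alg_mult (free_algebra N par) (Poly_Mapping.single u a)
        (alg_mult (free_algebra N par) (Poly_Mapping.single v b) z)"
      by (induction z rule: poly_mapping_single_induct)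
        (simp_all add: alg_mult_add alg_mult_single mult.assoc)
    then show ?case using add by (simp add: alg_mult_add)
  qed simp
  then show ?case using add by (simp add: alg_mult_add)
qed simp

lemma free_mult_one:
  "alg_mult (free_algebra N par) (Poly_Mapping.single [] 1) x = x"
  "alg_mult (free_algebra N par) x (Poly_Mapping.single [] 1) = x"
  by (induction x rule: poly_mapping_single_induct; simp add: alg_mult_add alg_mult_single)+

lemma keys_free_mult_subset:
  "Poly_Mapping.keys (alg_mult (free_algebra N par) x y) \<subseteq>
    {v @ w | v w. v \<in> Poly_Mapping.keys x \<and> w \<in> Poly_Mapping.keys y}"
  by (rule keys_alg_mult_subset) auto

lemma superalgebra_free: "superalgebra (free_superalgebra N par)"
proof (rule superalgebraI)
  let ?T = "free_superalgebra N par"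
  have mult_closed: "Poly_Mapping.keys (alg_mult (free_algebra N par) x y) \<subseteq> lists (gens N)"
    if "Poly_Mapping.keys x \<subseteq> lists (gens N)" "Poly_Mapping.keys y \<subseteq> lists (gens N)" for x y
    using keys_free_mult_subset[of N par x y] that by fastforce
  have add_closed: "Poly_Mapping.keys (x + y) \<subseteq> S"
    if "Poly_Mapping.keys x \<subseteq> S" "Poly_Mapping.keys y \<subseteq> S" for x y :: "gen list \<Rightarrow>\<^sub>0 ratfun" and S
    using keys_add[of x y] that by fast
  show "ring ?T"
  proof (rule ringI)
    show "abelian_group ?T"
    proof (rule abelian_groupI)
      show "\<exists>y\<in>carrier ?T. y \<oplus>\<^bsub>?T\<^esub> x = \<zero>\<^bsub>?T\<^esub>" if "x \<in> carrier ?T" for x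
        using that by (intro bexI[of _ "- x"]) simp_all
    qed (simp_all add: add_closed add_ac)
    show "monoid ?T"
      by (rule monoidI) (simp_all add: mult_closed free_mult_assoc free_mult_one)
  qed (simp_all add: alg_mult_add)
  show "x \<oplus>\<^bsub>?T\<^esub> y \<in> homog ?T d" if "x \<in> homog ?T d" "y \<in> homog ?T d" for x y d
    using that by (simp add: add_closed)
  show "c \<odot>\<^bsub>?T\<^esub> x \<in> homog ?T d" if "x \<in> homog ?T d" for c x d
    using that by (simp add: keys_subset_scale)
  show "\<exists>y\<in>homog ?T 0. \<exists>z\<in>homog ?T 1. x = y \<oplus>\<^bsub>?T\<^esub> z" if "x \<in> carrier ?T" for x
  proof (intro bexI)
    let ?p = "\<lambda>d. rescale (\<lambda>w. of_bool (word_parity par w = d)) x"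
    show "x = ?p 0 \<oplus>\<^bsub>?T\<^esub> ?p 1" by (simp, rule poly_mapping_eqI) (simp add: lookup_add)
    show "?p 0 \<in> homog ?T 0" "?p 1 \<in> homog ?T 1"
      using that by (auto simp: in_keys_iff)
  qed
  show "x = \<zero>\<^bsub>?T\<^esub>" if "x \<in> homog ?T 0" "x \<in> homog ?T 1" for x
  proof -
    have "Poly_Mapping.keys x = {}" using that by fastforce
    then show ?thesis by simp
  qed
  show "x \<otimes>\<^bsub>?T\<^esub> y \<in> homog ?T (d + e)" if "x \<in> homog ?T d" "y \<in> homog ?T e" for x y d e
    using keys_free_mult_subset[of N par x y] that by fastforce
qed (auto simp: keys_subset_scale scale_add_left scale_add_right alg_mult_scale)

abbreviation reorder :: "(nat \<Rightarrow> bit) \<Rightarrow> (gen list \<Rightarrow>\<^sub>0 ratfun) \<Rightarrow> (gen list \<Rightarrow>\<^sub>0 ratfun)" where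
  "reorder par \<equiv> rescale (word_sign par)"

lemma reorder_mult:
  assumes "x \<in> homog (free_superalgebra N par) d" "y \<in> homog (free_superalgebra N par) e"
  shows "reorder par (alg_mult (free_algebra N par) x y) =
    scale (zeta d e) (alg_mult (free_algebra N par) (reorder par x) (reorder par y))"
proof -
  have "reorder par (alg_mult (free_algebra N par) x y) =
    (\<Sum>v\<in>Poly_Mapping.keys x. \<Sum>w\<in>Poly_Mapping.keys y. Poly_Mapping.single (v @ w)
      (word_sign par (v @ w) * (Poly_Mapping.lookup x v * Poly_Mapping.lookup y w)))"
    by (simp add: alg_mult_def rescale_linear mult_ac)
  also have "\<dots> = (\<Sum>v\<in>Poly_Mapping.keys x. \<Sum>w\<in>Poly_Mapping.keys y. scale (zeta d e)
      (Poly_Mapping.single (v @ w) (Poly_Mapping.lookup (reorder par x) v *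
        Poly_Mapping.lookup (reorder par y) w)))"
    using assms by (intro sum.cong refl) (auto simp: word_sign_append mult_ac dest!: subsetD)
  also have "\<dots> = scale (zeta d e) (alg_mult (free_algebra N par) (reorder par x) (reorder par y))"
    by (simp add: alg_mult_def keys_rescale scale_sum)
  finally show ?thesis .
qed

lemma reorder_reorder [simp]: "reorder par (reorder par x) = x"
  by (rule poly_mapping_eqI) (simp flip: mult.assoc)

text \<open>Bijectivity holds because the signs square to one, so that rescaling is an involution.\<close>

lemma superalgebra_iso_reorder:
  "superalgebra_iso (free_superalgebra N par) (twist zeta (free_superalgebra N par)) (reorder par)"
proof (rule superalgebra_iso_twistI)
  let ?T = "free_superalgebra N par"
  show "bij_betw (reorder par) (carrier ?T) (carrier ?T)"
    by (rule bij_betw_byWitness[of _ "reorder par"]) (auto simp: keys_rescale)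
  show "reorder par \<one>\<^bsub>?T\<^esub> = \<one>\<^bsub>?T\<^esub>"
    by simp
qed (simp_all add: superalgebra_free normalized_2cocycle_zeta rescale_linear keys_rescale
    reorder_mult[unfolded free_superalgebra_simps])

section \<open>Even tensors with two matrix factors\<close>

abbreviation End2 ::
  "(bit \<times> bit \<Rightarrow> bit \<times> bit \<Rightarrow> ratfun) \<Rightarrow> nat \<Rightarrow> (nat \<Rightarrow> bit)
     \<Rightarrow> (bit \<times> bit, (nat \<times> nat) \<times> (nat \<times> nat)) based_algebra" where
  "End2 \<beta> N par \<equiv> tensor_algebra \<beta> (regrade (\<lambda>d. (0, d)) (End_V N par))
     (regrade (\<lambda>d. (0, d)) (End_V N par))"

definition end2_parity :: "(nat \<Rightarrow> bit) \<Rightarrow> (nat \<times> nat) \<times> (nat \<times> nat) \<Rightarrow> bit" where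
  "end2_parity par = (\<lambda>((i, j), (k, l)). (par i + par j) + (par k + par l))"

text \<open>Both matrix factors sit in the second component of the grading group, where the two
  bicharacters agree.\<close>

lemma bprod_End2:
  "bprod (End2 beta_total N par) = bprod (End2 beta_split N par)"
  by (intro ext)
    (auto simp: tensor_algebra_def regrade_def End_V_def beta_total_def beta_split_def split: prod.splits)

text \<open>A product of matrix units is nonzero only if the inner indices match, and the parity of the
  common inner index then occurs twice and cancels.\<close>

lemma keys_bprod_End2:
  "Poly_Mapping.keys (bprod (End2 \<beta> N par) e e') \<subseteq>
    {f. end2_parity par f = end2_parity par e + end2_parity par e'}"
proof -
  obtain i j k l i' j' k' l' where e: "e = ((i, j), (k, l))" "e' = ((i', j'), (k', l'))"
    by (metis surj_pair)
  have prod: "bprod (End2 \<beta> N par) e e' = scale (\<beta> (0, par k + par l) (0, par i' + par j'))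
      ((if j = i' then Poly_Mapping.single (i, j') 1 else 0) \<otimes>\<^sub>p
       (if l = k' then Poly_Mapping.single (k, l') 1 else 0))"
    by (simp add: e tensor_algebra_def regrade_def End_V_def)
  show ?thesis
  proof
    fix f assume "f \<in> Poly_Mapping.keys (bprod (End2 \<beta> N par) e e')"
    then have "f \<in> Poly_Mapping.keys (if j = i' then Poly_Mapping.single (i, j') (1::ratfun) else 0)
        \<times> Poly_Mapping.keys (if l = k' then Poly_Mapping.single (k, l') (1::ratfun) else 0)"
      unfolding prod by (rule subsetD[OF keys_subset_scale[OF keys_pure_tensor_subset]])
    then have f: "f = ((i, j'), (k, l'))" "j = i'" "l = k'" by (auto split: if_splits)
    have "(par i + par j) + (par k + par l) + ((par j + par j') + (par l + par l')) =
        (par i + par j') + (par k + par l') + ((par j + par j) + (par l + par l))"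
      by (simp only: add_ac)
    then show "f \<in> {f. end2_parity par f = end2_parity par e + end2_parity par e'}"
      unfolding e f end2_parity_def mem_Collect_eq prod.case
      by (simp only: f(2,3) bit_add_self add_0_right)
  qed
qed

lemma bprod_T_End2:
  "bprod (T_End2 \<beta> N par) (w, e) (w', e') =
    scale (\<beta> (0, end2_parity par e) (word_parity par w', 0))
      (Poly_Mapping.single (w @ w') 1 \<otimes>\<^sub>p bprod (End2 \<beta> N par) e e')"
proof -
  obtain i j k l i' j' k' l' where e: "e = ((i, j), (k, l))" "e' = ((i', j'), (k', l'))"
    by (metis surj_pair)
  show ?thesis
    unfolding e
    by (simp add: T_End2_def tensor_algebra_def regrade_def End_V_def free_algebra_def end2_parity_def)
qed

text \<open>On tensors of total parity zero, the sign of moving the matrix units past a later word can be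
  read off from the words alone.\<close>

definition even_basis ::
    "nat \<Rightarrow> (nat \<Rightarrow> bit) \<Rightarrow> (gen list \<times> (nat \<times> nat) \<times> (nat \<times> nat)) set" where
  "even_basis N par = {(w, e). w \<in> lists (gens N) \<and> word_parity par w = end2_parity par e}"

lemma even_basis_mult:
  assumes "Poly_Mapping.keys x \<subseteq> even_basis N par" "Poly_Mapping.keys y \<subseteq> even_basis N par"
  shows "Poly_Mapping.keys (alg_mult (T_End2 \<beta> N par) x y) \<subseteq> even_basis N par"
proof (rule keys_alg_mult_subset)
  fix a b assume "a \<in> Poly_Mapping.keys x" "b \<in> Poly_Mapping.keys y"
  then obtain w e w' e' where ab: "a = (w, e)" "b = (w', e')"
    "(w, e) \<in> even_basis N par" "(w', e') \<in> even_basis N par"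
    using assms by (metis subsetD surj_pair)
  show "Poly_Mapping.keys (bprod (T_End2 \<beta> N par) a b) \<subseteq> even_basis N par"
  proof
    fix c assume "c \<in> Poly_Mapping.keys (bprod (T_End2 \<beta> N par) a b)"
    then have "c \<in> Poly_Mapping.keys (Poly_Mapping.single (w @ w') (1::ratfun))
        \<times> Poly_Mapping.keys (bprod (End2 \<beta> N par) e e')"
      unfolding ab bprod_T_End2 by (rule subsetD[OF keys_subset_scale[OF keys_pure_tensor_subset]])
    then obtain f where f: "c = (w @ w', f)" "f \<in> Poly_Mapping.keys (bprod (End2 \<beta> N par) e e')"
      by auto
    from f(2) have "end2_parity par f = end2_parity par e + end2_parity par e'"
      using keys_bprod_End2 by blast
    then show "c \<in> even_basis N par" using ab(3,4) f(1) by (simp add: even_basis_def)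
  qed
qed

abbreviation reorder2 :: "(nat \<Rightarrow> bit) \<Rightarrow> mat2 \<Rightarrow> mat2" where
  "reorder2 par \<equiv> rescale (\<lambda>(w, e). word_sign par w)"

text \<open>With the split bicharacter no sign arises between words and matrices; with the total one
  the product of \<open>(w, e)\<close> and \<open>(w', e')\<close> carries the sign of moving \<open>e\<close> past \<open>w'\<close>. For even \<open>(w, e)\<close> this
  is \<open>\<zeta>(|w|, |w'|)\<close>, the same factor as in the sign of the word \<open>w @ w'\<close>.\<close>

lemma reorder2_mult:
  assumes x: "Poly_Mapping.keys x \<subseteq> even_basis N par"
  shows "reorder2 par (alg_mult (T_End2 beta_split N par) x y) =
    alg_mult (T_End2 beta_total N par) (reorder2 par x) (reorder2 par y)"
proof -
  let ?s = "\<lambda>(w, e :: (nat \<times> nat) \<times> (nat \<times> nat)). word_sign par w"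
  have "reorder2 par (bprod (T_End2 beta_split N par) a b) =
      scale (?s a * ?s b) (bprod (T_End2 beta_total N par) a b)"
    if "a \<in> Poly_Mapping.keys x" for a b
  proof -
    obtain w e w' e' where ab: "a = (w, e)" "b = (w', e')" by (metis surj_pair)
    have par: "word_parity par w = end2_parity par e"
      using that x ab by (auto simp: even_basis_def)
    have "reorder2 par (bprod (T_End2 beta_split N par) a b) =
        scale (word_sign par (w @ w'))
          (Poly_Mapping.single (w @ w') 1 \<otimes>\<^sub>p bprod (End2 beta_split N par) e e')"
      unfolding ab bprod_T_End2
      by (auto simp: beta_split_def parity_sign_def intro!: rescale_eq_scale
          dest!: subsetD[OF keys_pure_tensor_subset])
    also have "\<dots> = scale (?s a * ?s b) (bprod (T_End2 beta_total N par) a b)"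
      unfolding ab bprod_T_End2 bprod_End2
      by (simp add: word_sign_append par beta_total_def zeta_def mult_ac)
    finally show ?thesis .
  qed
  then have "reorder2 par (alg_mult (T_End2 beta_split N par) x y) =
      (\<Sum>a\<in>Poly_Mapping.keys x. \<Sum>b\<in>Poly_Mapping.keys y.
        scale (Poly_Mapping.lookup (reorder2 par x) a * Poly_Mapping.lookup (reorder2 par y) b)
          (bprod (T_End2 beta_total N par) a b))"
    unfolding alg_mult_def rescale_linear by (intro sum.cong refl) (simp add: mult_ac)
  moreover have "Poly_Mapping.keys (reorder2 par z) = Poly_Mapping.keys z" for z
    by (rule keys_rescale) (simp split: prod.split)
  ultimately show ?thesis by (simp add: alg_mult_def)
qed

text \<open>Words of at most one letter contain no pair of letters, so rescaling fixes their span.\<close>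

definition short_even_basis ::
    "nat \<Rightarrow> (nat \<Rightarrow> bit) \<Rightarrow> (gen list \<times> (nat \<times> nat) \<times> (nat \<times> nat)) set" where
  "short_even_basis N par = {(w, e) \<in> even_basis N par. length w \<le> 1}"

lemma reorder2_short:
  assumes "Poly_Mapping.keys x \<subseteq> short_even_basis N par"
  shows "reorder2 par x = x"
proof -
  have "word_sign par w = 1" if "length w \<le> 1" for w
    using that by (cases w) simp_all
  then have "reorder2 par x = scale 1 x"
    using assms by (intro rescale_eq_scale) (auto simp: short_even_basis_def)
  then show ?thesis by simp
qed

section \<open>The RLL relations\<close>

lemma keys_bunit_End: "Poly_Mapping.keys (bunit (End_V N par)) \<subseteq> {(k, k) | k. True}"
  unfolding End_V_def by (auto intro!: keys_subset_sum)

lemma keys_lgen: "Poly_Mapping.keys (lgen N s i j) \<subseteq> {[Gen s i j]} \<inter> lists (gens N)"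
  by (simp add: lgen_def)

lemma keys_L1: "Poly_Mapping.keys (L1 N par s) \<subseteq> short_even_basis N par"
  unfolding L1_def
proof (intro keys_subset_sum)
  fix i j
  show "Poly_Mapping.keys (lgen N s i j \<otimes>\<^sub>p Emat i j \<otimes>\<^sub>p bunit (End_V N par)) \<subseteq> short_even_basis N par"
    by (auto dest!: subsetD[OF keys_pure_tensor_subset] subsetD[OF keys_bunit_End]
        subsetD[OF keys_lgen] simp: Emat_def short_even_basis_def even_basis_def end2_parity_def)
qed

lemma keys_L2: "Poly_Mapping.keys (L2 N par s) \<subseteq> short_even_basis N par"
  unfolding L2_def
proof (intro keys_subset_sum)
  fix i j
  show "Poly_Mapping.keys (lgen N s i j \<otimes>\<^sub>p bunit (End_V N par) \<otimes>\<^sub>p Emat i j) \<subseteq> short_even_basis N par"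
    by (auto dest!: subsetD[OF keys_pure_tensor_subset] subsetD[OF keys_bunit_End]
        subsetD[OF keys_lgen] simp: Emat_def short_even_basis_def even_basis_def end2_parity_def)
qed

text \<open>The tensors \<open>E\<^sub>i\<^sub>i \<otimes> E\<^sub>j\<^sub>j\<close> and \<open>E\<^sub>i\<^sub>j \<otimes> E\<^sub>j\<^sub>i\<close> are even by inspection; in the remaining
  terms the second factor has the dual indices \<open>i'\<close>, \<open>j'\<close>, which have the parities of \<open>i\<close>, \<open>j\<close>.\<close>

lemma (in osp_data) keys_R_matrix:
  "Poly_Mapping.keys (R_matrix (m + n) par \<theta>) \<subseteq> {e. end2_parity par e = 0}"
  unfolding R_matrix_def
proof (intro keys_subset_diff keys_subset_scale keys_subset_sum)
  fix i j
  show "Poly_Mapping.keys (Emat i i \<otimes>\<^sub>p Emat j j) \<subseteq> {e. end2_parity par e = 0}"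
    by (auto dest!: subsetD[OF keys_pure_tensor_subset] simp: Emat_def end2_parity_def)
next
  fix p assume "p \<in> {(i, j). 1 \<le> i \<and> i < j \<and> j \<le> m + n}"
  then obtain i j where p: "p = (i, j)" and ij: "i \<in> {1..m + n}" "j \<in> {1..m + n}" by auto
  have dual: "par (dual_index (m + n) i) = par i" "par (dual_index (m + n) j) = par j"
    using ij[THEN par_sym] by (simp_all add: dual_index_def)
  define D where "D = Emat j i
    - scale (parity_sign (par j * (par i + par j)) * of_int (\<theta> i * \<theta> j)
        * qpow (R_exponent (m + n) par i j)) (Emat (dual_index (m + n) i) (dual_index (m + n) j))"
  have keys_D: "Poly_Mapping.keys D \<subseteq> {(j, i), (dual_index (m + n) i, dual_index (m + n) j)}"
    unfolding D_def by (intro keys_subset_diff keys_subset_scale) (simp_all add: Emat_def)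
  have "Poly_Mapping.keys (Emat i j \<otimes>\<^sub>p D) \<subseteq> {e. end2_parity par e = 0}"
  proof
    fix e assume "e \<in> Poly_Mapping.keys (Emat i j \<otimes>\<^sub>p D)"
    then have "e \<in> Poly_Mapping.keys (Emat i j) \<times> Poly_Mapping.keys D"
      by (rule subsetD[OF keys_pure_tensor_subset])
    then have "e = ((i, j), (j, i)) \<or> e = ((i, j), (dual_index (m + n) i, dual_index (m + n) j))"
      using keys_D by (auto simp: Emat_def)
    then show "e \<in> {e. end2_parity par e = 0}"
      by (auto simp: end2_parity_def dual add.commute)
  qed
  then show "Poly_Mapping.keys (case p of (i, j) \<Rightarrow> scale (parity_sign (par j))
      (Emat i j \<otimes>\<^sub>p (Emat j i - scale (parity_sign (par j * (par i + par j)) * of_int (\<theta> i * \<theta> j)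
        * qpow (R_exponent (m + n) par i j)) (Emat (dual_index (m + n) i) (dual_index (m + n) j)))))
      \<subseteq> {e. end2_parity par e = 0}"
    unfolding p prod.case by (intro keys_subset_scale) (simp add: D_def)
qed

lemma (in osp_data) keys_R12:
  "Poly_Mapping.keys (R12 (m + n) par \<theta>) \<subseteq> short_even_basis (m + n) par"
  unfolding R12_def
  by (auto dest!: subsetD[OF keys_pure_tensor_subset] subsetD[OF keys_R_matrix]
      simp: short_even_basis_def even_basis_def)

context osp_data
begin

lemma short_even_basis_subset: "short_even_basis N par \<subseteq> even_basis N par"
  by (auto simp: short_even_basis_def)

lemmas keys_even = keys_R12[THEN order.trans, OF short_even_basis_subset]
  keys_L1[THEN order.trans, OF short_even_basis_subset]
  keys_L2[THEN order.trans, OF short_even_basis_subset]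

lemma keys_RLL_defect:
  "Poly_Mapping.keys (RLL_defect \<beta> (m + n) par \<theta> s t) \<subseteq> even_basis (m + n) par"
  unfolding RLL_defect_def Let_def
  by (intro keys_subset_diff even_basis_mult keys_even)

lemma reorder2_RLL_defect:
  "reorder2 par (RLL_defect beta_split (m + n) par \<theta> s t) = RLL_defect beta_total (m + n) par \<theta> s t"
  unfolding RLL_defect_def Let_def rescale_linear
  by (simp add: reorder2_mult even_basis_mult keys_even
      reorder2_short[OF keys_R12] reorder2_short[OF keys_L1] reorder2_short[OF keys_L2])

lemma diagonal_relation:
  assumes "i \<in> {1..N}"
  shows "alg_mult (free_algebra N par) (lgen N s i i) (lgen N t i i) =
    Poly_Mapping.single [Gen s i i, Gen t i i] 1"
proof -
  have "Gen s i i \<in> gens N" "Gen t i i \<in> gens N"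
    using assms by (cases s; cases t; force simp: gens_def)+
  then show ?thesis by (simp add: lgen_def alg_mult_single)
qed

text \<open>The diagonal relations are fixed, since diagonal generators are even. The matrix
  relations correspond to each other because taking a coefficient along a matrix basis element
  commutes with rescaling words.\<close>

lemma reorder_relations:
  "reorder par ` RLL_relations beta_split (m + n) par \<theta> = RLL_relations beta_total (m + n) par \<theta>"
proof -
  let ?T = "free_algebra (m + n) par"
  let ?D = "\<lambda>s t. {alg_mult ?T (lgen (m + n) s i i) (lgen (m + n) t i i) - bunit ?T | i. i \<in> {1..m + n}}"
  let ?C = "\<lambda>\<beta>. {coefficient (RLL_defect \<beta> (m + n) par \<theta> s t) e | s t e.
          (s, t) \<in> {(Plus, Plus), (Minus, Minus), (Plus, Minus)} \<and>
          e \<in> ({1..m + n} \<times> {1..m + n}) \<times> ({1..m + n} \<times> {1..m + n})}"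
  have diag: "reorder par x = x" if "x \<in> ?D s t" for s t x
    using that by (auto simp: diagonal_relation rescale_linear)
  have D: "reorder par ` ?D s t = ?D s t" for s t
    using diag[of _ s t] by (intro trans[OF image_cong image_ident] refl)
  have "coefficient (RLL_defect beta_total (m + n) par \<theta> s t) e =
      reorder par (coefficient (RLL_defect beta_split (m + n) par \<theta> s t) e)" for s t e
    by (simp only: coefficient_rescale flip: reorder2_RLL_defect)
  then have C: "reorder par ` ?C beta_split = ?C beta_total" by (simp only:) blast
  show ?thesis unfolding RLL_relations_def Let_def image_Un C D ..
qed

text \<open>A coefficient of an even tensor along a matrix basis element has the parity of that basis
  element.\<close>

lemma RLL_relations_homogeneous:
  "RLL_relations \<beta> (m + n) par \<theta> \<subseteq> (\<Union>d. homog (free_superalgebra (m + n) par) d)"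
proof
  let ?T = "free_algebra (m + n) par"
  fix x assume "x \<in> RLL_relations \<beta> (m + n) par \<theta>"
  then consider
      (diag) s t i where "i \<in> {1..m + n}"
        "x = alg_mult ?T (lgen (m + n) s i i) (lgen (m + n) t i i) - bunit ?T"
    | (coeff) s t e where "x = coefficient (RLL_defect \<beta> (m + n) par \<theta> s t) e"
    unfolding RLL_relations_def Let_def by blast
  then show "x \<in> (\<Union>d. homog (free_superalgebra (m + n) par) d)"
  proof cases
    case diag
    then have "Gen s i i \<in> gens (m + n)" "Gen t i i \<in> gens (m + n)"
      by (cases s; cases t; force simp: gens_def)+
    then have words: "{[Gen s i i, Gen t i i], []}
        \<subseteq> {w \<in> lists (gens (m + n)). word_parity par w = 0}"
      by simp
    have "Poly_Mapping.keys x \<subseteq> {[Gen s i i, Gen t i i], []}"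
      unfolding diag(2) diagonal_relation[OF diag(1)] by (intro keys_subset_diff) simp_all
    then have "x \<in> homog (free_superalgebra (m + n) par) 0"
      using order.trans[OF _ words] by simp
    then show ?thesis by blast
  next
    case coeff
    then have "x \<in> homog (free_superalgebra (m + n) par) (end2_parity par e)"
      using keys_RLL_defect[of \<beta> s t] by (auto simp: in_keys_iff even_basis_def)
    then show ?thesis by blast
  qed
qed

end

theorem proposition5p17:
  fixes m n :: nat and par :: "nat \<Rightarrow> bit" and \<theta> :: "nat \<Rightarrow> int"
  assumes "osp_data m n par \<theta>"
  shows "\<exists>\<phi>. superalgebra_iso (U_RLL_twisted (m + n) par \<theta>) (twist zeta (U_RLL (m + n) par \<theta>)) \<phi> \<and>
    (\<forall>s i j. Gen s i j \<in> gens (m + n) \<longrightarrow>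
       \<phi> (RLL_gen beta_split (m + n) par \<theta> s i j) = RLL_gen beta_total (m + n) par \<theta> s i j)"
proof -
  interpret osp_data m n par \<theta> by fact
  let ?T = "free_superalgebra (m + n) par"
  interpret T: superalgebra ?T by (rule superalgebra_free)
  note iso = superalgebra_iso_reorder[of "m + n" par]
  note homogeneous = RLL_relations_homogeneous[of beta_split]
  have ideal: "reorder par ` RLL_ideal beta_split (m + n) par \<theta> = RLL_ideal beta_total (m + n) par \<theta>"
    unfolding RLL_ideal_def reorder_relations[symmetric]
    by (rule image_genideal_twist[OF iso superalgebra_free normalized_2cocycle_zeta homogeneous])
  have graded: "T.graded_ideal (RLL_ideal beta_split (m + n) par \<theta>)"
    unfolding RLL_ideal_def by (rule T.graded_ideal_genideal[OF homogeneous])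
  note quotient = superalgebra_iso_quotient[OF iso superalgebra_free normalized_2cocycle_zeta graded,
      unfolded ideal]
  show ?thesis
  proof (intro exI conjI allI impI)
    show "superalgebra_iso (U_RLL_twisted (m + n) par \<theta>) (twist zeta (U_RLL (m + n) par \<theta>))
        ((`) (reorder par))"
      unfolding U_RLL_twisted_def U_RLL_def RLL_superalgebra_def by (rule quotient(1))
    fix s i j assume g: "Gen s i j \<in> gens (m + n)"
    then have "lgen (m + n) s i j \<in> carrier ?T" by (simp add: lgen_def)
    moreover have "reorder par (lgen (m + n) s i j) = lgen (m + n) s i j"
      using g by (simp add: lgen_def)
    ultimately show "reorder par ` RLL_gen beta_split (m + n) par \<theta> s i j =
        RLL_gen beta_total (m + n) par \<theta> s i j"
      unfolding RLL_gen_def using quotient(2) by metis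
  qed
qed

end
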